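(* Let $B\in\mathbb{R}_{\ge1}$, $\mu\in(0,1]$, $q\in\mathbb{Z}_{\ge1}$, and $h=\lfloor\log^{(q)}L\rfloor$. Let $x\in P_B$ with $\mathrm{supp}(x)\subseteq V_{>h}$, and let $W=\{u\in\Gamma\mid x(P_u)\ge\mu\}$. Then one can efficiently compute a set $R\subseteq V_{>h}$ such that (i) $R\cap P_u\ne\emptyset$ for all $u\in W$, and (ii) $\chi^R\in P_{B'}$, where $B'=\frac{q}{\mu}B+1$ and $\chi^R\in\{0,1\}^{V\setminus\{r\}}$ is the characteristic vector of $R$.
   Context: $G=(V,E)$ is a tree rooted at $r$ with depth $L$ (the largest distance from $r$). $V_\ell$ is the set of vertices at distance $\ell$ from $r$, $V_{>h}=\bigcup_{\ell>h}V_\ell$, $\Gamma$ the set of leaves, $P_u$ the vertex set of the $u$-$r$ path excluding $r$, and $x(U)=\sum_{u\in U}x(u)$. For $B\ge0$, $P_B=\{x\in\mathbb{R}_{\ge0}^{V\setminus\{r\}}\mid x(V_\ell)\le B\cdot2^\ell\ \forall\ell\in[L]\}$. Logarithms are base $2$; $\log^{(q)}L$ is the $q$-fold iterated logarithm of $L$, with $\log^{(0)}L=L$. $\mathrm{supp}(x)=\{v\mid x(v)>0\}$. *)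

theory Defs
  imports "HOL-Analysis.Analysis" "Graph_Theory.Graph_Theory"
begin

section \<open>Rooted trees\<close>

text \<open>
  A finite simple undirected graph is a \<^locale>\<open>pair_graph\<close>: a finite, loop-free, symmetric
  digraph without parallel arcs.  The constant \<^const>\<open>tree\<close> of the library cannot be used for it:
  it forbids all directed cycles, so that an edge together with its reverse already counts as a
  cycle.  Cycles of an undirected graph have length at least three.
\<close>

definition rooted_tree :: "'a pair_pre_digraph \<Rightarrow> 'a \<Rightarrow> bool" where
  "rooted_tree G r \<longleftrightarrow>
     pair_graph G \<and> connected (with_proj G) \<and>
     (\<nexists>p. pre_digraph.cycle (with_proj G) p \<and> 3 \<le> length p) \<and>
     r \<in> pverts G"

definition gdist :: "'a pair_pre_digraph \<Rightarrow> 'a \<Rightarrow> 'a \<Rightarrow> nat" where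
  "gdist G u v = (LEAST k. \<exists>p. pre_digraph.awalk (with_proj G) u p v \<and> length p = k)"

definition depth :: "'a pair_pre_digraph \<Rightarrow> 'a \<Rightarrow> nat" where
  "depth G r = Max ((\<lambda>v. gdist G r v) ` pverts G)"

definition level :: "'a pair_pre_digraph \<Rightarrow> 'a \<Rightarrow> nat \<Rightarrow> 'a set" where
  "level G r l = {v \<in> pverts G. gdist G r v = l}"

text \<open>The threshold is an integer because \<open>\<lfloor>log\<^sup>(\<^sup>q\<^sup>) L\<rfloor>\<close> may be negative.\<close>

definition levels_above :: "'a pair_pre_digraph \<Rightarrow> 'a \<Rightarrow> int \<Rightarrow> 'a set" where
  "levels_above G r h = (\<Union>l\<in>{l. int l > h}. level G r l)"

definition leaves :: "'a pair_pre_digraph \<Rightarrow> 'a \<Rightarrow> 'a set" where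
  "leaves G r = {v \<in> pverts G - {r}. out_degree (with_proj G) v = 1}"

text \<open>In a tree there is exactly one path from \<open>u\<close> to \<open>r\<close>.\<close>

definition root_path :: "'a pair_pre_digraph \<Rightarrow> 'a \<Rightarrow> 'a \<Rightarrow> 'a set" where
  "root_path G r u =
     {v. \<exists>p. pre_digraph.apath (with_proj G) u p r \<and>
             v \<in> set (pre_digraph.awalk_verts (with_proj G) u p)} - {r}"


section \<open>The polytope and iterated logarithms\<close>

text \<open>
  A vector indexed by the vertices other than the root is a function whose values at the root and
  outside the graph are never inspected.
\<close>

definition P :: "'a pair_pre_digraph \<Rightarrow> 'a \<Rightarrow> real \<Rightarrow> ('a \<Rightarrow> real) set" where
  "P G r B = {x. (\<forall>v \<in> pverts G - {r}. 0 \<le> x v) \<and>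
                 (\<forall>l \<in> {1..depth G r}. sum x (level G r l) \<le> B * 2 ^ l)}"

definition supp :: "'a pair_pre_digraph \<Rightarrow> 'a \<Rightarrow> ('a \<Rightarrow> real) \<Rightarrow> 'a set" where
  "supp G r x = {v \<in> pverts G - {r}. x v > 0}"

definition iter_log :: "nat \<Rightarrow> real \<Rightarrow> real" where
  "iter_log q y = ((log 2) ^^ q) y"

text \<open>Every logarithm taken in the iteration has a positive argument.\<close>

definition iter_log_defined :: "nat \<Rightarrow> real \<Rightarrow> bool" where
  "iter_log_defined q y \<longleftrightarrow> (\<forall>i<q. 0 < iter_log i y)"


section \<open>Programs over the reals with unit cost\<close>

text \<open>
  The data are arbitrary real numbers, so the machine model is that of a unit-cost real RAM:
  natural numbers serve as indices and counters, real numbers can only be added, subtracted,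
  multiplied, divided and compared.  Multiplication of naturals and rounding of reals are absent
  on purpose; with unit cost they would make the model unrealistically strong.  Programs have
  bounded loops only, whose bound is evaluated once on entry.  Hence every program terminates,
  and each is also an ordinary RAM program.

  Memory consists of named two-dimensional arrays; scalars and vectors use index 0 in the
  unused dimensions.
\<close>

record store =
  nats :: "string \<Rightarrow> nat \<Rightarrow> nat \<Rightarrow> nat"
  reals :: "string \<Rightarrow> nat \<Rightarrow> nat \<Rightarrow> real"

datatype nexp =
    NConst nat
  | NGet string nexp nexp
  | NAdd nexp nexp
  | NSub nexp nexp

datatype rexp =
    ROfNat nexp
  | RGet string nexp nexp
  | RAdd rexp rexp
  | RSub rexp rexp
  | RMul rexp rexp
  | RDiv rexp rexp

datatype test =
    NLe nexp nexp
  | RLe rexp rexp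
  | Neg test
  | Conj test test

datatype com =
    Skip
  | NSet string nexp nexp nexp
  | RSet string nexp nexp rexp
  | Seq com com
  | If test com com
  | For string nexp com

primrec nval :: "nexp \<Rightarrow> store \<Rightarrow> nat" where
  "nval (NConst n) s = n"
| "nval (NGet a i j) s = nats s a (nval i s) (nval j s)"
| "nval (NAdd d e) s = nval d s + nval e s"
| "nval (NSub d e) s = nval d s - nval e s"

primrec rval :: "rexp \<Rightarrow> store \<Rightarrow> real" where
  "rval (ROfNat e) s = real (nval e s)"
| "rval (RGet a i j) s = reals s a (nval i s) (nval j s)"
| "rval (RAdd d e) s = rval d s + rval e s"
| "rval (RSub d e) s = rval d s - rval e s"
| "rval (RMul d e) s = rval d s * rval e s"
| "rval (RDiv d e) s = rval d s / rval e s"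

primrec holds :: "test \<Rightarrow> store \<Rightarrow> bool" where
  "holds (NLe d e) s \<longleftrightarrow> nval d s \<le> nval e s"
| "holds (RLe d e) s \<longleftrightarrow> rval d s \<le> rval e s"
| "holds (Neg b) s \<longleftrightarrow> \<not> holds b s"
| "holds (Conj b c) s \<longleftrightarrow> holds b s \<and> holds c s"

definition put_nat :: "string \<Rightarrow> nat \<Rightarrow> nat \<Rightarrow> nat \<Rightarrow> store \<Rightarrow> store" where
  "put_nat a i j n s = s\<lparr>nats := (nats s)(a := (nats s a)(i := (nats s a i)(j := n)))\<rparr>"

definition put_real :: "string \<Rightarrow> nat \<Rightarrow> nat \<Rightarrow> real \<Rightarrow> store \<Rightarrow> store" where
  "put_real a i j y s = s\<lparr>reals := (reals s)(a := (reals s a)(i := (reals s a i)(j := y)))\<rparr>"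

primrec run :: "com \<Rightarrow> store \<Rightarrow> store" where
  "run Skip s = s"
| "run (NSet a i j e) s = put_nat a (nval i s) (nval j s) (nval e s) s"
| "run (RSet a i j e) s = put_real a (nval i s) (nval j s) (rval e s) s"
| "run (Seq c d) s = run d (run c s)"
| "run (If b c d) s = (if holds b s then run c s else run d s)"
| "run (For v e c) s = fold (\<lambda>i s. run c (put_nat v 0 0 i s)) [0..<nval e s] s"

text \<open>
  Each assignment, test and loop iteration costs one unit.  The expressions in a fixed program have
  bounded size, so counting their operators would change the time only by a constant factor.
\<close>

primrec time :: "com \<Rightarrow> store \<Rightarrow> nat" where
  "time Skip s = 1"
| "time (NSet a i j e) s = 1"
| "time (RSet a i j e) s = 1"
| "time (Seq c d) s = time c s + time d (run c s)"
| "time (If b c d) s = 1 + (if holds b s then time c s else time d s)"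
| "time (For v e c) s =
     1 + (\<Sum>k<nval e s.
            1 + time c (put_nat v 0 0 k
                          (fold (\<lambda>i s. run c (put_nat v 0 0 i s)) [0..<k] s)))"


section \<open>Input and output\<close>

text \<open>
  The tree is given by its adjacency matrix with respect to a list \<open>vs\<close> enumerating the vertices.
  Depth, levels, leaves, root paths and logarithms are not part of the input.
\<close>

definition input_store ::
  "'a pair_pre_digraph \<Rightarrow> 'a \<Rightarrow> 'a list \<Rightarrow> real \<Rightarrow> real \<Rightarrow> nat \<Rightarrow> ('a \<Rightarrow> real) \<Rightarrow> store" where
  "input_store G r vs B \<mu> q x =
     \<lparr>nats = (\<lambda>a i j.
        if a = ''n'' \<and> i = 0 \<and> j = 0 then length vs
        else if a = ''q'' \<and> i = 0 \<and> j = 0 then q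
        else if a = ''root'' \<and> i < length vs \<and> j = 0 then of_bool (vs ! i = r)
        else if a = ''adj'' \<and> i < length vs \<and> j < length vs
          then of_bool ((vs ! i, vs ! j) \<in> parcs G)
        else 0),
      reals = (\<lambda>a i j.
        if a = ''B'' \<and> i = 0 \<and> j = 0 then B
        else if a = ''mu'' \<and> i = 0 \<and> j = 0 then \<mu>
        else if a = ''x'' \<and> i < length vs \<and> j = 0 \<and> vs ! i \<noteq> r then x (vs ! i)
        else 0)\<rparr>"

definition output_set :: "'a list \<Rightarrow> store \<Rightarrow> 'a set" where
  "output_set vs s = {vs ! i | i. i < length vs \<and> nats s ''R'' i 0 \<noteq> 0}"

end

theory Submission
  imports Defs "HOL-Library.Discrete_Functions"
begin

text \<open>
  Cut the levels at \<open>h\<^sub>0 = L\<close>, \<open>h\<^sub>1 = \<lfloor>log h\<^sub>0\<rfloor>\<close>, \<open>h\<^sub>2 = \<lfloor>log h\<^sub>1\<rfloor>\<close>, \<dots> into groups.  For every vertex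
  let \<open>p\<close> be the sum of \<open>q x / \<mu>\<close> along its path up to the top of its group, truncated at 1.  A leaf in
  \<open>W\<close> has an ancestor with \<open>p = 1\<close>, because its path crosses at most \<open>q\<close> groups that \<open>x\<close> meets.  Call a
  vertex free if its value lies strictly between that of its parent (0 at the top of a group)
  and 1.  If a group has more free vertices than levels, some nonzero direction keeps all tight
  inequalities tight and all level sums of \<open>p v - p (parent v)\<close> constant; moving along it until a
  further inequality becomes tight loses a free vertex.  In the end each group has at most as many
  free vertices as levels, that is at most \<open>2\<^sup>l\<close> for each of its levels \<open>l\<close>.  \<open>R\<close> consists of the
  topmost vertices with \<open>p > 0\<close> in each group: on level \<open>l\<close>, those with \<open>p = 1\<close> are paid for by the level
  sum and the others are free.

  A direction is found by eliminating one inequality at a time from the standard basis.  As each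
  inequality concerns a single group, all groups can be treated at once.
\<close>

section \<open>Rooted trees\<close>

text \<open>The factor \<open>q / \<mu>\<close> is a pigeonhole: weight \<open>\<mu>\<close> on a
  path through at most \<open>q\<close> groups leaves scaled weight 1 in one of them. In the bound
  on \<open>R\<close>, the summand \<open>q / \<mu> * B\<close> pays for the level sums, which
  truncation at 1 can only lower, and the summand 1 pays for the free vertices. Passing from
  \<open>x\<close> to path sums turns covering into the sparse constraints
  \<open>p (parent v) \<le> p v\<close> and \<open>p v \<le> 1\<close>, each within a single group.
  One row per non-free vertex expresses all tight constraints, so in a group with more free vertices
  than levels these rows and the level rows are together fewer than the vertices; hence the kernel
  direction. Its orientation is irrelevant: scaled to 1 at some vertex, it must run into a bound.
  Values 0 and 1 never change along it: the zeros keep \<open>R\<close> above level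
  \<open>h\<close>, the ones keep the leaves covered. Elimination and the search for the step length
  need only field operations and comparisons of reals, which is all that the machine model
  grants.\<close>

locale rooted =
  fixes G :: "'a pair_pre_digraph" and r :: 'a
  assumes rooted_tree: "rooted_tree G r"
begin

sublocale pair_graph G
  using rooted_tree by (simp add: rooted_tree_def)

lemma root_in_verts: "r \<in> pverts G"
  using rooted_tree by (simp add: rooted_tree_def)

lemma no_long_cycle: "cycle p \<Longrightarrow> length p < 3"
  using rooted_tree by (force simp: rooted_tree_def)

lemma reachable_all: "u \<in> pverts G \<Longrightarrow> v \<in> pverts G \<Longrightarrow> u \<rightarrow>\<^sup>*\<^bsub>with_proj G\<^esub> v"
  using rooted_tree unfolding rooted_tree_def connected_def strongly_connected_def
  by (simp add: reachable_mk_symmetric_eq[OF sym_arcs])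

lemma gdist_le: "awalk r p v \<Longrightarrow> gdist G r v \<le> length p"
  unfolding gdist_def by (rule Least_le) auto

lemma gdist_awalk:
  assumes "v \<in> pverts G"
  obtains p where "awalk r p v" "length p = gdist G r v"
proof -
  obtain p where "awalk r p v"
    using reachable_all[OF root_in_verts assms] unfolding reachable_awalk by auto
  then have "\<exists>k. \<exists>p. awalk r p v \<and> length p = k" by auto
  from LeastI_ex[OF this] show ?thesis
    using that unfolding gdist_def by auto
qed

lemma gdist_root [simp]: "gdist G r r = 0"
  using gdist_le[of "[]" r] root_in_verts by (simp add: awalk_Nil_iff)

lemma gdist_eq_0_iff: "v \<in> pverts G \<Longrightarrow> gdist G r v = 0 \<longleftrightarrow> v = r"
  by (rule gdist_awalk[of v]) (auto simp: awalk_Nil_iff)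

lemma gdist_less_card: "v \<in> pverts G \<Longrightarrow> gdist G r v < card (pverts G)"
  using reachable_all[OF root_in_verts, of v]
  by (auto simp: reachable_apath dest: length_apath_less intro: le_less_trans[OF gdist_le[OF awalkI_apath]])

lemma gdist_arc: 
  assumes "(u, v) \<in> parcs G"
  shows "gdist G r v \<le> Suc (gdist G r u)"
proof -
  obtain p where "awalk r p u" "length p = gdist G r u"
    using gdist_awalk assms in_arcsD1 by metis
  moreover have "awalk u [(u, v)] v"
    using assms by (auto simp: awalk_simps intro: in_arcsD1 in_arcsD2)
  ultimately show ?thesis
    using gdist_le[of "p @ [(u, v)]" v] by auto
qed

lemma pred_exists:
  assumes "v \<in> pverts G" "v \<noteq> r"
  shows "\<exists>u. (u, v) \<in> parcs G \<and> gdist G r v = Suc (gdist G r u)"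
proof -
  obtain p where p: "awalk r p v" "length p = gdist G r v"
    using gdist_awalk assms by metis
  then have "p \<noteq> []" using assms by (auto simp: awalk_Nil_iff)
  then obtain q e where q: "p = q @ [e]" by (metis rev_exhaust)
  with p(1) have e: "awalk r q (fst e)" "e \<in> parcs G" "snd e = v"
    by (auto simp: awalk_simps)
  then have "gdist G r (fst e) \<le> length q" using gdist_le by blast
  moreover have "(fst e, v) \<in> parcs G" using e by (metis prod.collapse)
  moreover have "gdist G r v = Suc (length q)" using p q by simp
  ultimately show ?thesis
    using gdist_arc by (metis Suc_le_mono le_antisym)
qed

text \<open>The root is its own parent, so that \<open>parent\<close> can be iterated freely;
  \<open>pred_unique\<close> shows that the choice of \<open>u\<close> is forced.\<close>

definition parent :: "'a \<Rightarrow> 'a" where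
  "parent v = (if v = r then r else SOME u. (u, v) \<in> parcs G \<and> gdist G r v = Suc (gdist G r u))"

lemma parent_root [simp]: "parent r = r"
  by (simp add: parent_def)

lemma
  assumes "v \<in> pverts G" "v \<noteq> r"
  shows parent_arc: "(parent v, v) \<in> parcs G"
    and gdist_parent: "gdist G r v = Suc (gdist G r (parent v))"
  using someI_ex[OF pred_exists[OF assms]] assms(2) by (auto simp: parent_def)

lemma parent_in_verts: "v \<in> pverts G \<Longrightarrow> parent v \<in> pverts G"
  using parent_arc parent_root in_arcsD1 by metis

text \<open>The arcs of a shortest-path tree in both orientations; the absence of long cycles will
  show that \<open>G\<close> has no others.\<close>

definition tree_arcs :: "('a \<times> 'a) set" where
  "tree_arcs = (\<Union>v\<in>pverts G - {r}. {(parent v, v), (v, parent v)})"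

lemma tree_arcs_awalk:
  assumes "v \<in> pverts G"
  shows "\<exists>p. awalk v p r \<and> set p \<subseteq> tree_arcs"
  using assms
proof (induction "gdist G r v" arbitrary: v)
  case 0
  then show ?case
    using gdist_eq_0_iff[of v] by (intro exI[of _ "[]"]) (auto simp: awalk_Nil_iff)
next
  case (Suc k)
  then have "v \<noteq> r" by auto
  note a = parent_arc[OF \<open>v \<in> pverts G\<close> this] gdist_parent[OF \<open>v \<in> pverts G\<close> this]
  obtain p where "awalk (parent v) p r" "set p \<subseteq> tree_arcs"
    using Suc a parent_in_verts by (metis Suc_inject)
  then show ?case
    using a \<open>v \<noteq> r\<close> \<open>v \<in> pverts G\<close> arcs_symmetric[OF a(1)]
    by (intro exI[of _ "(v, parent v) # p"]) (auto simp: awalk_simps tree_arcs_def)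
qed

lemma rev_path_tree_arcs: "set p \<subseteq> tree_arcs \<Longrightarrow> set (rev_path p) \<subseteq> tree_arcs"
  by (induction p) (auto simp: tree_arcs_def)

text \<open>An arc outside \<open>tree_arcs\<close> closes a path along \<open>tree_arcs\<close> to a cycle of length at least three.\<close>

lemma arc_in_tree_arcs:
  assumes uv: "(u, v) \<in> parcs G"
  shows "(u, v) \<in> tree_arcs"
proof (rule ccontr)
  assume not: "(u, v) \<notin> tree_arcs"
  have V: "u \<in> pverts G" "v \<in> pverts G" "u \<noteq> v"
    using uv in_arcsD1 in_arcsD2 no_loops' by auto
  obtain p q where pq: "awalk u p r" "set p \<subseteq> tree_arcs" "awalk v q r" "set q \<subseteq> tree_arcs"
    using tree_arcs_awalk V by meson
  define w where "w = awalk_to_apath (p @ rev_path q)"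
  have walk: "awalk u (p @ rev_path q) v" using pq by auto
  then have w: "apath u w v"
    unfolding w_def by (rule apath_awalk_to_apath)
  have "set w \<subseteq> set (p @ rev_path q)"
    unfolding w_def by (rule awalk_to_apath_subset[OF walk])
  then have w_arcs: "set w \<subseteq> tree_arcs"
    using pq rev_path_tree_arcs[OF pq(4)] by auto
  \<comment> \<open>A shorter \<open>w\<close> would be empty, against \<open>u \<noteq> v\<close>,
    or the arc \<open>(u, v)\<close> itself, against \<open>not\<close>.\<close>
  have "2 \<le> length w"
  proof (rule ccontr)
    assume "\<not> 2 \<le> length w"
    then consider "w = []" | e where "w = [e]"
      by (cases w; cases "tl w") auto
    then show False
      using w w_arcs V not
      by cases (auto simp: apath_simps)
  qed
  moreover have "cycle ((v, u) # w)"
    unfolding cycle_def using w arcs_symmetric[OF uv]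
    by (intro exI[of _ v]) (auto simp: apath_def awalk_simps)
  ultimately show False
    using no_long_cycle by fastforce
qed

lemma arc_cases:
  assumes "(u, v) \<in> parcs G"
  shows "v \<noteq> r \<and> u = parent v \<or> u \<noteq> r \<and> v = parent u"
  using arc_in_tree_arcs[OF assms] by (auto simp: tree_arcs_def)

lemma pred_unique:
  assumes "(u, v) \<in> parcs G" "gdist G r u < gdist G r v"
  shows "u = parent v"
  using arc_cases[OF assms(1)] assms gdist_parent[of u] in_arcsD1 by fastforce

text \<open>The second assumption places \<open>w\<close> in the subtree below \<open>z\<close>. A
  step to a child increases \<open>k\<close>, a step to the parent decreases it, and the only exit
  from the subtree, at \<open>k = 0\<close>, leads from \<open>z\<close> to
  \<open>parent z\<close>.\<close>

lemma awalk_to_root_visits_parent: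
  assumes "awalk w p r" "(parent ^^ k) w = z" "z \<noteq> r"
  shows "parent z \<in> set (awalk_verts w p)"
  using assms
proof (induction p arbitrary: w k)
  case Nil
  have "(parent ^^ k) r = r" by (induction k) auto
  with Nil show ?case by (auto simp: awalk_Nil_iff)
next
  case (Cons e p)
  obtain w' where e: "e = (w, w')" "(w, w') \<in> parcs G" and w': "awalk w' p r"
    using Cons.prems(1) by (cases e) (auto simp: awalk_simps)
  show ?case
  proof (cases "w = parent w'")
    case True
    then have "(parent ^^ Suc k) w' = z"
      using Cons.prems(2) by (simp add: funpow_swap1)
    with Cons.IH[OF w' this Cons.prems(3)] show ?thesis by (simp add: e)
  next
    case False
    then have w'_eq: "w' = parent w" using arc_cases[OF e(2)] by auto
    show ?thesis
    proof (cases k)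
      case 0
      then show ?thesis
        using Cons.prems w'_eq w' by (cases p) (auto simp: e awalk_simps)
    next
      case (Suc j)
      then have "(parent ^^ j) w' = z"
        using Cons.prems(2) w'_eq by (simp add: funpow_swap1)
      with Cons.IH[OF w' this Cons.prems(3)] show ?thesis by (simp add: e)
    qed
  qed
qed

text \<open>A first step down to a child of \<open>v\<close> would force the rest of the path to
  pass through \<open>v\<close> again on its way to the root.\<close>

lemma apath_to_root_Cons:
  assumes "apath v (e # p) r"
  shows "e = (v, parent v) \<and> apath (parent v) p r \<and> v \<noteq> r \<and> v \<notin> set (awalk_verts (parent v) p)"
proof -
  obtain w where e: "e = (v, w)" "(v, w) \<in> parcs G" and w: "apath w p r"
    and v: "v \<notin> set (awalk_verts w p)"
    using assms by (cases e) (auto simp: apath_simps)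
  have "w = parent v"
  proof (rule ccontr)
    assume "w \<noteq> parent v"
    then have "w \<noteq> r" "v = parent w" using arc_cases[OF e(2)] by auto
    with awalk_to_root_visits_parent[of w p 0 w] w v show False
      by (auto simp: apath_def)
  qed
  moreover have "v \<noteq> r"
  proof
    assume "v = r"
    then have "awalk w p v" using w by (auto simp: apath_def)
    then have "last (awalk_verts w p) = v" by auto
    moreover have "awalk_verts w p \<noteq> []" by (cases p) auto
    ultimately show False using v last_in_set by metis
  qed
  ultimately show ?thesis using e w v by auto
qed

lemma apath_to_root_gdist:
  assumes "apath v p r" "w \<in> set (awalk_verts v p)"
  shows "gdist G r w \<le> gdist G r v"
  using assms
proof (induction p arbitrary: v)
  case Nil
  then show ?case by simp
next
  case (Cons e p)
  note e = apath_to_root_Cons[OF Cons.prems(1)]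
  have "v \<in> pverts G" using Cons.prems by (auto simp: apath_def)
  then have "gdist G r v = Suc (gdist G r (parent v))" using e gdist_parent by auto
  then show ?case using Cons e by fastforce
qed

lemma root_path_root: "root_path G r r = {}"
proof -
  have "p = []" if "apath r p r" for p
    using that apath_to_root_Cons by (cases p) auto
  then show ?thesis by (fastforce simp: root_path_def)
qed

text \<open>Replaces the path-based definition by a recursion along \<open>parent\<close>; all later
  statements about root paths are inductions on this equation.\<close>

lemma root_path_parent:
  assumes v: "v \<in> pverts G" "v \<noteq> r"
  shows "root_path G r v = insert v (root_path G r (parent v))" (is "?A = ?B")
    and "v \<notin> root_path G r (parent v)"
proof -
  have new: "v \<notin> set (awalk_verts (parent v) p)" if "apath (parent v) p r" for p
    using apath_to_root_gdist[OF that] gdist_parent[OF v] by fastforce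
  have ap: "apath v ((v, parent v) # p) r" if "apath (parent v) p r" for p
    using that new[OF that] arcs_symmetric[OF parent_arc[OF v]] by (auto simp: apath_simps)
  obtain p where p: "apath (parent v) p r"
    using reachable_all[OF parent_in_verts[OF v(1)] root_in_verts] by (auto simp: reachable_apath)
  show "?A = ?B"
  proof (intro equalityI subsetI)
    fix w assume "w \<in> ?A"
    then obtain q where q: "apath v q r" "w \<in> set (awalk_verts v q)" "w \<noteq> r"
      by (auto simp: root_path_def)
    with v obtain e q' where "q = e # q'"
      by (cases q) (auto simp: apath_simps)
    with q apath_to_root_Cons[of v e q'] show "w \<in> ?B"
      by (auto simp: root_path_def)
  next
    fix w assume "w \<in> ?B"
    then consider "w = v" | q where "apath (parent v) q r" "w \<in> set (awalk_verts (parent v) q)" "w \<noteq> r"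
      by (auto simp: root_path_def)
    then show "w \<in> ?A"
    proof cases
      case 1
      then show ?thesis using ap[OF p] v by (force simp: root_path_def)
    next
      case 2
      then show ?thesis using ap[of q] by (force simp: root_path_def)
    qed
  qed
  show "v \<notin> root_path G r (parent v)"
    using new by (auto simp: root_path_def)
qed

lemma root_path_mono:
  assumes "v \<in> pverts G" "w \<in> root_path G r v"
  shows "root_path G r w \<subseteq> root_path G r v \<and> gdist G r w \<le> gdist G r v"
  using assms
proof (induction "gdist G r v" arbitrary: v)
  case 0
  then show ?case using gdist_eq_0_iff[of v] root_path_root by simp
next
  case (Suc k)
  then have v: "v \<noteq> r" by auto
  note p = gdist_parent[OF Suc.prems(1) v] root_path_parent(1)[OF Suc.prems(1) v]
  have "w = v \<or> w \<in> root_path G r (parent v)" using Suc.prems(2) p by auto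
  then show ?case
  proof
    assume "w \<in> root_path G r (parent v)"
    then have "root_path G r w \<subseteq> root_path G r (parent v) \<and> gdist G r w \<le> gdist G r (parent v)"
      using Suc p parent_in_verts by (metis Suc_inject)
    then show ?thesis using p by auto
  qed simp
qed

lemma root_path_subset: "v \<in> pverts G \<Longrightarrow> root_path G r v \<subseteq> pverts G - {r}"
  by (auto simp: root_path_def apath_def)

lemma finite_root_path: "v \<in> pverts G \<Longrightarrow> finite (root_path G r v)"
  using root_path_subset pair_finite_verts by (meson finite_Diff finite_subset)

end

section \<open>Reasoning about programs\<close>

lemma nats_put [simp]:
  "nats (put_nat a i j m s) b k l = (if b = a \<and> k = i \<and> l = j then m else nats s b k l)"
  "nats (put_real a i j y s) = nats s"
  by (auto simp: put_nat_def put_real_def)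

lemma reals_put [simp]:
  "reals (put_real a i j y s) b k l = (if b = a \<and> k = i \<and> l = j then y else reals s b k l)"
  "reals (put_nat a i j m s) = reals s"
  by (auto simp: put_nat_def put_real_def)

lemma put_other [simp]:
  "a \<noteq> b \<Longrightarrow> nats (put_nat b i j m s) a = nats s a"
  "a \<noteq> b \<Longrightarrow> reals (put_real b i j y s) a = reals s a"
  by (auto intro!: ext)

primrec nwrites :: "com \<Rightarrow> string set" where
  "nwrites Skip = {}"
| "nwrites (NSet a i j e) = {a}"
| "nwrites (RSet a i j e) = {}"
| "nwrites (Seq c d) = nwrites c \<union> nwrites d"
| "nwrites (If b c d) = nwrites c \<union> nwrites d"
| "nwrites (For v e c) = insert v (nwrites c)"

primrec rwrites :: "com \<Rightarrow> string set" where
  "rwrites Skip = {}"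
| "rwrites (NSet a i j e) = {}"
| "rwrites (RSet a i j e) = {a}"
| "rwrites (Seq c d) = rwrites c \<union> rwrites d"
| "rwrites (If b c d) = rwrites c \<union> rwrites d"
| "rwrites (For v e c) = rwrites c"

lemma fold_invariant_upt:
  assumes "Inv 0 s" and "\<And>k s. k < n \<Longrightarrow> Inv k s \<Longrightarrow> Inv (Suc k) (f k s)"
  shows "Inv n (fold f [0..<n] s)"
  using assms by (induction n) auto

lemma nats_frame: "a \<notin> nwrites c \<Longrightarrow> nats (run c s) a = nats s a"
proof (induction c arbitrary: s)
  case (For v e c)
  then have "nats (fold (\<lambda>i s. run c (put_nat v 0 0 i s)) [0..<k] s) a = nats s a" for k
    by (induction k) (auto intro!: ext)
  then show ?case by simp
qed (auto intro!: ext)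

lemma reals_frame: "a \<notin> rwrites c \<Longrightarrow> reals (run c s) a = reals s a"
proof (induction c arbitrary: s)
  case (For v e c)
  then have "reals (fold (\<lambda>i s. run c (put_nat v 0 0 i s)) [0..<k] s) a = reals s a" for k
    by (induction k) (auto intro!: ext)
  then show ?case by simp
qed (auto intro!: ext)

lemma run_For_rule:
  assumes "nval e s = n" and "Inv 0 s"
    and "\<And>k s. k < n \<Longrightarrow> Inv k s \<Longrightarrow> Inv (Suc k) (run c (put_nat v 0 0 k s))"
  shows "Inv n (run (For v e c) s)"
  using fold_invariant_upt[of Inv s n] assms by simp

abbreviation nvar :: "string \<Rightarrow> nexp" where
  "nvar a \<equiv> NGet a (NConst 0) (NConst 0)"

abbreviation loop :: "string \<Rightarrow> com \<Rightarrow> com" where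
  "loop v c \<equiv> For v (nvar ''n'') c"

text \<open>The frame conditions are built into the step, so an invariant has to mention only the
  arrays that the body changes; all others are read off the entry store \<open>s0\<close>.\<close>

lemma run_loop:
  assumes "nats s0 ''n'' 0 0 = n" and "Inv 0 s0"
    and step: "\<And>k s. k < n \<Longrightarrow> Inv k s \<Longrightarrow>
      (\<And>a. a \<notin> insert v (nwrites c) \<Longrightarrow> nats s a = nats s0 a) \<Longrightarrow>
      (\<And>a. a \<notin> rwrites c \<Longrightarrow> reals s a = reals s0 a) \<Longrightarrow>
      Inv (Suc k) (run c (put_nat v 0 0 k s))"
  shows "Inv n (run (loop v c) s0)"
proof -
  let ?Inv = "\<lambda>k s. Inv k s \<and> (\<forall>a. a \<notin> insert v (nwrites c) \<longrightarrow> nats s a = nats s0 a) \<and>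
    (\<forall>a. a \<notin> rwrites c \<longrightarrow> reals s a = reals s0 a)"
  have "?Inv n (run (loop v c) s0)"
  proof (rule run_For_rule)
    fix k s assume "k < n" and inv: "?Inv k s"
    then have "Inv (Suc k) (run c (put_nat v 0 0 k s))" using step by blast
    moreover have "nats (run c (put_nat v 0 0 k s)) a = nats s0 a" if "a \<notin> insert v (nwrites c)" for a
      using inv that by (auto simp: nats_frame intro!: ext)
    moreover have "reals (run c (put_nat v 0 0 k s)) a = reals s0 a" if "a \<notin> rwrites c" for a
      using inv that by (simp add: reals_frame)
    ultimately show "?Inv (Suc k) (run c (put_nat v 0 0 k s))" by blast
  qed (use assms in auto)
  then show ?thesis by blast
qed

section \<open>Polynomial running time from loop nesting\<close>

primrec n_bounded :: "com \<Rightarrow> bool" where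
  "n_bounded Skip \<longleftrightarrow> True"
| "n_bounded (NSet a i j e) \<longleftrightarrow> True"
| "n_bounded (RSet a i j e) \<longleftrightarrow> True"
| "n_bounded (Seq c d) \<longleftrightarrow> n_bounded c \<and> n_bounded d"
| "n_bounded (If b c d) \<longleftrightarrow> n_bounded c \<and> n_bounded d"
| "n_bounded (For v e c) \<longleftrightarrow> e = nvar ''n'' \<and> n_bounded c"

primrec nesting :: "com \<Rightarrow> nat" where
  "nesting Skip = 0"
| "nesting (NSet a i j e) = 0"
| "nesting (RSet a i j e) = 0"
| "nesting (Seq c d) = max (nesting c) (nesting d)"
| "nesting (If b c d) = max (nesting c) (nesting d)"
| "nesting (For v e c) = Suc (nesting c)"

text \<open>The 2 of a loop covers its entry and the unit per iteration:
  \<open>1 + n \<le> 2 * n ^ k\<close> for \<open>k \<ge> 1\<close>.\<close>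

primrec com_size :: "com \<Rightarrow> nat" where
  "com_size Skip = 1"
| "com_size (NSet a i j e) = 1"
| "com_size (RSet a i j e) = 1"
| "com_size (Seq c d) = com_size c + com_size d"
| "com_size (If b c d) = 1 + com_size c + com_size d"
| "com_size (For v e c) = 2 + com_size c"

text \<open>All loops share a bound that is never overwritten, so nested loops multiply to a power
  of \<open>n\<close>; \<open>1 \<le> n\<close> lets the shallower parts be raised to the common
  exponent.\<close>

lemma time_le:
  assumes "n_bounded c" "''n'' \<notin> nwrites c" "nats s ''n'' 0 0 = n" "1 \<le> n"
  shows "time c s \<le> com_size c * n ^ nesting c"
  using assms
proof (induction c arbitrary: s)
  case (Seq c d)
  have "nats (run c s) ''n'' 0 0 = n"
    using Seq.prems by (simp add: nats_frame)
  then have "time c s \<le> com_size c * n ^ nesting c"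
    and "time d (run c s) \<le> com_size d * n ^ nesting d"
    using Seq by auto
  then have "time c s \<le> com_size c * n ^ nesting (Seq c d)"
    and "time d (run c s) \<le> com_size d * n ^ nesting (Seq c d)"
    using \<open>1 \<le> n\<close> by (auto elim!: order_trans intro!: power_increasing)
  then show ?case by (simp add: add_mult_distrib)
next
  case (If b c d)
  then have "time c s \<le> com_size c * n ^ nesting c"
    and "time d s \<le> com_size d * n ^ nesting d"
    by auto
  then have "time c s \<le> com_size c * n ^ nesting (If b c d)"
    and "time d s \<le> com_size d * n ^ nesting (If b c d)"
    and "1 \<le> n ^ nesting (If b c d)"
    using \<open>1 \<le> n\<close> by (auto elim!: order_trans intro!: power_increasing)
  then show ?case by (auto simp add: add_mult_distrib)
next
  case (For v e c)
  let ?s = "\<lambda>k. fold (\<lambda>i s. run c (put_nat v 0 0 i s)) [0..<k] s"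
  have "nats (?s k) ''n'' = nats s ''n''" for k
    using For.prems nats_frame[of "''n''" c] by (induction k) (auto intro!: ext)
  then have "time c (put_nat v 0 0 k (?s k)) \<le> com_size c * n ^ nesting c" for k
    using For.IH[of "put_nat v 0 0 k (?s k)"] For.prems by auto
  then have le: "(\<Sum>k<n. 1 + time c (put_nat v 0 0 k (?s k))) \<le> (\<Sum>k<n. 1 + com_size c * n ^ nesting c)"
    by (intro sum_mono add_left_mono)
  have "nval e s = n" using For.prems by simp
  then have "time (For v e c) s = 1 + (\<Sum>k<n. 1 + time c (put_nat v 0 0 k (?s k)))"
    by (simp only: time.simps)
  also note add_left_mono[OF le, of 1]
  also have "1 + (\<Sum>k<n. 1 + com_size c * n ^ nesting c) = 1 + n + com_size c * n ^ Suc (nesting c)"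
    by simp
  also have "\<dots> \<le> 2 * n ^ Suc (nesting c) + com_size c * n ^ Suc (nesting c)"
    using \<open>1 \<le> n\<close> self_le_power[of n "Suc (nesting c)"] by linarith
  finally show ?case by (simp add: add_mult_distrib)
qed auto

section \<open>Rounding potentials on a layered forest\<close>

text \<open>
  The vertices are the numbers below \<open>n\<close>.  \<open>ep v\<close> is the parent of \<open>v\<close> if it lies in the group of \<open>v\<close>, and
  the dummy index \<open>n\<close>, where all potentials and directions vanish, if \<open>v\<close> is at the top of its group.
\<close>

locale layered_forest =
  fixes n :: nat and lev ep :: "nat \<Rightarrow> nat"
  assumes ep_le: "v < n \<Longrightarrow> ep v \<le> n"
    and lev_ep: "v < n \<Longrightarrow> ep v < n \<Longrightarrow> lev v = Suc (lev (ep v))"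
begin

lemma ep_cases:
  assumes "v < n"
  obtains "ep v = n" | "ep v < n" "lev v = Suc (lev (ep v))"
  using assms ep_le lev_ep by (metis le_neq_implies_less)

lemma forest_induct [consumes 1, case_names top step]:
  assumes "v < n"
    and "\<And>v. v < n \<Longrightarrow> ep v = n \<Longrightarrow> Q v"
    and "\<And>v. v < n \<Longrightarrow> ep v < n \<Longrightarrow> lev v = Suc (lev (ep v)) \<Longrightarrow> Q (ep v) \<Longrightarrow> Q v"
  shows "Q v"
  using assms(1)
proof (induction "lev v" arbitrary: v rule: less_induct)
  case less
  from less.prems show ?case
    by (cases rule: ep_cases) (use assms less in auto)
qed

text \<open>Stands for a union of groups: no link \<open>ep\<close> crosses the boundary of
  \<open>S\<close>. In this form the elimination argument is independent of how the levels are
  cut.\<close>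

definition closed_levels :: "nat set \<Rightarrow> bool" where
  "closed_levels S \<longleftrightarrow> (\<forall>v<n. ep v < n \<longrightarrow> (lev v \<in> S \<longleftrightarrow> lev (ep v) \<in> S))"

definition potential :: "(nat \<Rightarrow> real) \<Rightarrow> bool" where
  "potential p \<longleftrightarrow> p n = 0 \<and> (\<forall>v<n. p (ep v) \<le> p v \<and> p v \<le> 1)"

definition free :: "(nat \<Rightarrow> real) \<Rightarrow> nat set" where
  "free p = {v. v < n \<and> p (ep v) < p v \<and> p v < 1}"

text \<open>Counting levels below \<open>n\<close> matches the load rows, which are indexed by
  \<open>{..<n}\<close>, and makes the cardinality meaningful for infinite \<open>S\<close>.\<close>

definition balanced :: "(nat \<Rightarrow> real) \<Rightarrow> bool" where
  "balanced p \<longleftrightarrow>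
     (\<forall>S. closed_levels S \<longrightarrow> card {v \<in> free p. lev v \<in> S} \<le> card (S \<inter> {..<n}))"

definition level_load :: "nat \<Rightarrow> (nat \<Rightarrow> real) \<Rightarrow> real" where
  "level_load l d = (\<Sum>v | v < n \<and> lev v = l. d v - d (ep v))"

text \<open>One row per vertex keeps the count exact. If \<open>p k\<close> equals both
  \<open>p (ep k)\<close> and 1, the equation \<open>d k = d (ep k)\<close> suffices, because
  \<open>d (ep k) = 0\<close> is then inherited from further up.\<close>

definition tightness :: "(nat \<Rightarrow> real) \<Rightarrow> nat \<Rightarrow> (nat \<Rightarrow> real) \<Rightarrow> real" where
  "tightness p k d =
     (if p k \<le> p (ep k) then d k - d (ep k) else if 1 \<le> p k then d k else 0)"

lemma closed_levels_Compl: "closed_levels S \<Longrightarrow> closed_levels (- S)"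
  by (auto simp: closed_levels_def)

lemma finite_free [simp]: "finite (free p)"
  by (simp add: free_def)

lemma potential_nonneg:
  assumes "potential p" "v < n"
  shows "0 \<le> p v"
  using assms(2)
proof (induction v rule: forest_induct)
  case (top v)
  with assms(1) show ?case by (metis potential_def)
next
  case (step v)
  with assms(1) show ?case by (metis order_trans potential_def)
qed

section \<open>Elimination that respects groups\<close>

text \<open>Linearity in the form that a pivot step uses. The case \<open>c = 0\<close> says that
  \<open>f\<close> depends only on the entries up to \<open>n\<close>, which are the ones the arrays
  control.\<close>

definition linear_row :: "((nat \<Rightarrow> real) \<Rightarrow> real) \<Rightarrow> bool" where
  "linear_row f \<longleftrightarrow>
     (\<forall>a b d c. (\<forall>v\<le>n. d v = a v - c * b v) \<longrightarrow> f d = f a - c * f b)"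

text \<open>Lets one elimination serve all groups: a row attached to level \<open>l\<close> cannot
  affect a direction that lives in other groups.\<close>

definition local_row :: "nat \<Rightarrow> ((nat \<Rightarrow> real) \<Rightarrow> real) \<Rightarrow> bool" where
  "local_row l f \<longleftrightarrow>
     (\<forall>S d. closed_levels S \<longrightarrow> l \<notin> S \<longrightarrow> d n = 0 \<longrightarrow>
       (\<forall>v<n. d v \<noteq> 0 \<longrightarrow> lev v \<in> S) \<longrightarrow> f d = 0)"

lemma linear_tightness: "k < n \<Longrightarrow> linear_row (tightness p k)"
  using ep_le[of k] by (simp add: linear_row_def tightness_def algebra_simps)

lemma local_tightness: "k < n \<Longrightarrow> local_row (lev k) (tightness p k)"
  unfolding local_row_def
proof (intro allI impI)
  fix S and d :: "nat \<Rightarrow> real"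
  assume S: "closed_levels S" "lev k \<notin> S" and d: "d n = 0" "\<forall>v<n. d v \<noteq> 0 \<longrightarrow> lev v \<in> S"
    and k: "k < n"
  then have "d k = 0" by auto
  moreover from k have "d (ep k) = 0"
    by (cases rule: ep_cases) (use S d k in \<open>auto simp: closed_levels_def\<close>)
  ultimately show "tightness p k d = 0" by (simp add: tightness_def)
qed

lemma linear_level_load: "linear_row (level_load l)"
  unfolding linear_row_def level_load_def sum_distrib_left sum_subtractf[symmetric]
  using ep_le by (auto intro!: sum.cong simp: algebra_simps)

lemma local_level_load: "local_row l (level_load l)"
  unfolding local_row_def level_load_def
proof (intro allI impI sum.neutral ballI)
  fix S and d :: "nat \<Rightarrow> real" and v
  assume S: "closed_levels S" "l \<notin> S" and d: "d n = 0" "\<forall>v<n. d v \<noteq> 0 \<longrightarrow> lev v \<in> S"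
    and v: "v \<in> {v. v < n \<and> lev v = l}"
  then have "v < n" by simp
  then have "d (ep v) = 0"
    by (cases rule: ep_cases) (use S d v in \<open>auto simp: closed_levels_def\<close>)
  then show "d v - d (ep v) = 0" using S d v by auto
qed

text \<open>
  Direction \<open>D i\<close> is alive for \<open>i \<in> A\<close>.  A row \<open>f\<close> kills at most one direction \<open>j\<close>; subtracting
  multiples of \<open>D j\<close> moves the remaining ones into the kernel of \<open>f\<close>.
\<close>

definition pivot_step ::
  "((nat \<Rightarrow> real) \<Rightarrow> real) \<Rightarrow> nat set \<Rightarrow> (nat \<Rightarrow> nat \<Rightarrow> real) \<Rightarrow> nat set \<Rightarrow> (nat \<Rightarrow> nat \<Rightarrow> real) \<Rightarrow> bool"
where
  "pivot_step f A D A' D' \<longleftrightarrow>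
     A' = A \<and> (\<forall>i\<in>A. f (D i) = 0 \<and> (\<forall>v\<le>n. D' i v = D i v)) \<or>
     (\<exists>j\<in>A. f (D j) \<noteq> 0 \<and> A' = A - {j} \<and>
        (\<forall>i\<in>A'. \<forall>v\<le>n. D' i v = D i v - f (D i) / f (D j) * D j v))"

text \<open>Every dead index \<open>i\<close> is charged to a row of its own group of levels; \<open>b S\<close> counts those rows.\<close>

definition elimination_inv ::
  "((nat \<Rightarrow> real) \<Rightarrow> real) set \<Rightarrow> (nat set \<Rightarrow> nat) \<Rightarrow> nat set \<Rightarrow> (nat \<Rightarrow> nat \<Rightarrow> real) \<Rightarrow> bool"
where
  "elimination_inv F b A D \<longleftrightarrow>
     A \<subseteq> {..<n} \<and>
     (\<forall>i\<in>A. D i i = 1 \<and> D i n = 0 \<and> (\<forall>j\<in>A. j \<noteq> i \<longrightarrow> D i j = 0)) \<and>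
     (\<forall>i\<in>A. \<forall>S. closed_levels S \<longrightarrow> lev i \<in> S \<longrightarrow> (\<forall>v<n. D i v \<noteq> 0 \<longrightarrow> lev v \<in> S)) \<and>
     (\<forall>f\<in>F. \<forall>i\<in>A. f (D i) = 0) \<and>
     (\<forall>S. closed_levels S \<longrightarrow> card {i. i < n \<and> i \<notin> A \<and> lev i \<in> S} \<le> b S)"

lemma elimination_invI:
  assumes "A \<subseteq> {..<n}"
    and "\<And>i. i \<in> A \<Longrightarrow> D i i = 1 \<and> D i n = 0 \<and> (\<forall>j\<in>A. j \<noteq> i \<longrightarrow> D i j = 0)"
    and "\<And>i S v. i \<in> A \<Longrightarrow> closed_levels S \<Longrightarrow> lev i \<in> S \<Longrightarrow> v < n \<Longrightarrow> D i v \<noteq> 0 \<Longrightarrow> lev v \<in> S"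
    and "\<And>f i. f \<in> F \<Longrightarrow> i \<in> A \<Longrightarrow> f (D i) = 0"
    and "\<And>S. closed_levels S \<Longrightarrow> card {i. i < n \<and> i \<notin> A \<and> lev i \<in> S} \<le> b S"
  shows "elimination_inv F b A D"
proof -
  have "\<forall>i\<in>A. D i i = 1 \<and> D i n = 0 \<and> (\<forall>j\<in>A. j \<noteq> i \<longrightarrow> D i j = 0)"
    by (intro ballI assms(2))
  moreover have "\<forall>i\<in>A. \<forall>S. closed_levels S \<longrightarrow> lev i \<in> S \<longrightarrow> (\<forall>v<n. D i v \<noteq> 0 \<longrightarrow> lev v \<in> S)"
    by (intro ballI allI impI) (rule assms(3))
  moreover have "\<forall>f\<in>F. \<forall>i\<in>A. f (D i) = 0"
    by (intro ballI) (rule assms(4))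
  moreover have "\<forall>S. closed_levels S \<longrightarrow> card {i. i < n \<and> i \<notin> A \<and> lev i \<in> S} \<le> b S"
    by (intro allI impI assms(5))
  ultimately show ?thesis
    unfolding elimination_inv_def using assms(1) by (intro conjI)
qed

lemma elimination_inv_init:
  assumes "\<And>i v. i < n \<Longrightarrow> v \<le> n \<Longrightarrow> D i v = of_bool (v = i)"
  shows "elimination_inv {} (\<lambda>_. 0) {..<n} D"
proof -
  have "{i. i < n \<and> i \<notin> {..<n} \<and> lev i \<in> S} = {}" for S by auto
  then show ?thesis
    using assms by (auto simp: elimination_inv_def)
qed

text \<open>Support and counting both rest on \<open>row_in\<close>: a direction on which
  \<open>f\<close> does not vanish belongs to the same closed level sets as \<open>l\<close>, so the
  killed index is charged to the right group. The factor \<open>\<exists>d. f d \<noteq> 0\<close>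
  exempts zero rows, which kill nothing.\<close>

lemma elimination_inv_step:
  assumes inv: "elimination_inv F b A D"
    and step: "pivot_step f A D A' D'"
    and F: "\<And>g. g \<in> insert f F \<Longrightarrow> linear_row g"
    and loc: "local_row l f"
    and b': "\<And>S. closed_levels S \<Longrightarrow> b S + of_bool (l \<in> S \<and> (\<exists>d. f d \<noteq> 0)) \<le> b' S"
  shows "elimination_inv (insert f F) b' A' D'"
proof -
  from inv have A: "A \<subseteq> {..<n}"
    and D1: "\<And>i. i \<in> A \<Longrightarrow> D i i = 1" and Dn: "\<And>i. i \<in> A \<Longrightarrow> D i n = 0"
    and D0: "\<And>i j. i \<in> A \<Longrightarrow> j \<in> A \<Longrightarrow> j \<noteq> i \<Longrightarrow> D i j = 0"
    and Dsupp: "\<And>i S v. i \<in> A \<Longrightarrow> closed_levels S \<Longrightarrow> lev i \<in> S \<Longrightarrow> v < n \<Longrightarrow> D i v \<noteq> 0 \<Longrightarrow> lev v \<in> S"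
    and DF: "\<And>g i. g \<in> F \<Longrightarrow> i \<in> A \<Longrightarrow> g (D i) = 0"
    and count: "\<And>S. closed_levels S \<Longrightarrow> card {i. i < n \<and> i \<notin> A \<and> lev i \<in> S} \<le> b S"
    unfolding elimination_inv_def by auto
  have row_in: "l \<in> S" if "i \<in> A" "f (D i) \<noteq> 0" "closed_levels S" "lev i \<in> S" for i S
    using loc that Dsupp[OF that(1,3,4)] Dn[OF that(1)] unfolding local_row_def by blast
  have lin: "g d = g a - c * g e" if "g \<in> insert f F" "\<And>v. v \<le> n \<Longrightarrow> d v = a v - c * e v" for g a d c e
    using F[OF that(1)] that(2) unfolding linear_row_def by blast
  from step[unfolded pivot_step_def] consider
    (keep) "A' = A" "\<And>i. i \<in> A \<Longrightarrow> f (D i) = 0" "\<And>i v. i \<in> A \<Longrightarrow> v \<le> n \<Longrightarrow> D' i v = D i v"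
  | (kill) j where "j \<in> A" "f (D j) \<noteq> 0" "A' = A - {j}"
      "\<And>i v. i \<in> A' \<Longrightarrow> v \<le> n \<Longrightarrow> D' i v = D i v - f (D i) / f (D j) * D j v"
  proof (elim disjE bexE conjE, goal_cases)
    case 1
    then show ?case by simp
  next
    case (2 j)
    then show ?case by blast
  qed
  then show ?thesis
  proof cases
    case keep
    have "g (D' i) = g (D i)" if "g \<in> insert f F" "i \<in> A" for g i
      using lin[OF that(1), of "D' i" "D i" 0 "D i"] keep(3)[OF that(2)] by simp
    note same = this
    have "g (D' i) = 0" if "g \<in> insert f F" "i \<in> A" for g i
      using same[OF that] that(1) keep(2)[OF that(2)] DF[OF _ that(2)] by auto
    moreover have "card {i. i < n \<and> i \<notin> A \<and> lev i \<in> S} \<le> b' S" if "closed_levels S" for S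
      using b'[OF that] count[OF that] by simp
    moreover have "D' i i = 1 \<and> D' i n = 0 \<and> (\<forall>j\<in>A. j \<noteq> i \<longrightarrow> D' i j = 0)" if "i \<in> A" for i
      using keep(3)[OF that] A that D1 Dn D0 by auto
    moreover have "lev v \<in> S"
      if "i \<in> A" "closed_levels S" "lev i \<in> S" "v < n" "D' i v \<noteq> 0" for i S v
      using Dsupp[OF that(1-4)] keep(3)[OF that(1), of v] that(4,5) by simp
    ultimately show ?thesis
      unfolding keep(1) using A by (intro elimination_invI)
  next
    case kill
    have j: "j < n" using kill A by auto
    have alive: "i \<in> A" "i \<noteq> j" "i < n" if "i \<in> A'" for i using that kill A by auto
    have "g (D' i) = g (D i) - f (D i) / f (D j) * g (D j)" if "g \<in> insert f F" "i \<in> A'" for g i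
      by (rule lin[OF that(1)]) (use kill(4)[OF that(2)] in auto)
    note image = this
    have kernel: "g (D' i) = 0" if "g \<in> insert f F" "i \<in> A'" for g i
    proof (cases "g = f")
      case True
      then show ?thesis using image[OF that] kill(2) by simp
    next
      case False
      then have "g \<in> F" using that by simp
      then show ?thesis
        using image[OF that] DF[OF _ kill(1), of g] DF[OF _ alive(1)[OF that(2)], of g] by simp
    qed
    have supp: "lev v \<in> S"
      if i: "i \<in> A'" and S: "closed_levels S" "lev i \<in> S" and v: "v < n" "D' i v \<noteq> 0" for i S v
    proof (cases "D i v = 0")
      case False
      with Dsupp alive i S v show ?thesis by blast
    next
      case True
      with kill(4)[OF i, of v] v have nz: "f (D i) \<noteq> 0" "D j v \<noteq> 0" by auto
      have "l \<in> S" using row_in[OF _ nz(1) S] alive i by auto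
      \<comment> \<open>Otherwise \<open>row_in\<close> for the complement of \<open>S\<close> would
        place \<open>l\<close> outside \<open>S\<close>.\<close>
      then have "lev j \<in> S"
        using row_in[OF kill(1,2) closed_levels_Compl[OF S(1)]] by auto
      with Dsupp[OF kill(1) S(1)] v nz show ?thesis by auto
    qed
    have cnt: "card {i. i < n \<and> i \<notin> A' \<and> lev i \<in> S} \<le> b' S" if S: "closed_levels S" for S
    proof (cases "lev j \<in> S")
      case True
      have "{i. i < n \<and> i \<notin> A' \<and> lev i \<in> S} = insert j {i. i < n \<and> i \<notin> A \<and> lev i \<in> S}"
        using True j kill by auto
      then have "card {i. i < n \<and> i \<notin> A' \<and> lev i \<in> S} \<le> Suc (b S)"
        using count[OF S] by (simp add: card_insert_if)
      moreover have "l \<in> S \<and> (\<exists>d. f d \<noteq> 0)" using row_in[OF kill(1,2) S True] kill(2) by blast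
      ultimately show ?thesis using b'[OF S] by simp
    next
      case False
      then have "{i. i < n \<and> i \<notin> A' \<and> lev i \<in> S} = {i. i < n \<and> i \<notin> A \<and> lev i \<in> S}"
        using j kill by auto
      then show ?thesis using count[OF S] b'[OF S] by auto
    qed
    \<comment> \<open>\<open>D j\<close> vanishes at all other alive indices, so subtracting a
      multiple of it leaves the unit pattern on \<open>A'\<close> intact.\<close>
    have "D' i k = 0" if "i \<in> A'" "k \<in> A'" "k \<noteq> i" for i k
      using kill(4)[OF that(1), of k] alive[OF that(1)] alive[OF that(2)]
        D0[of i k] D0[of j k] kill(1) that(3) by simp
    then have "D' i i = 1 \<and> D' i n = 0 \<and> (\<forall>k\<in>A'. k \<noteq> i \<longrightarrow> D' i k = 0)" if "i \<in> A'" for i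
      using kill(4)[OF that] alive[OF that] D1[of i] Dn[of i] Dn[of j] D0[of j i] kill(1) that
      by simp
    moreover have "A' \<subseteq> {..<n}" using A kill(3) by auto
    ultimately show ?thesis
      using supp kernel cnt by (intro elimination_invI)
  qed
qed

text \<open>Without alive indices every vertex is charged to a row, so the vertices in
  \<open>S\<close> number at most the non-free ones plus the levels; cancelling the non-free ones
  bounds the free ones.\<close>

lemma balanced_if_all_killed:
  assumes "potential p" "elimination_inv F b {} D"
    and "\<And>S. closed_levels S \<Longrightarrow>
      b S = card {k. k < n \<and> k \<notin> free p \<and> lev k \<in> S} + card (S \<inter> {..<n})"
  shows "balanced p"
  unfolding balanced_def
proof (intro allI impI)
  fix S assume S: "closed_levels S"
  have "{i. i < n \<and> lev i \<in> S} =
      {v \<in> free p. lev v \<in> S} \<union> {k. k < n \<and> k \<notin> free p \<and> lev k \<in> S}"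
    by (auto simp: free_def)
  then have "card {i. i < n \<and> lev i \<in> S} =
      card {v \<in> free p. lev v \<in> S} + card {k. k < n \<and> k \<notin> free p \<and> lev k \<in> S}"
    by (simp add: card_Un_disjoint disjoint_iff)
  moreover have "card {i. i < n \<and> lev i \<in> S} \<le> b S"
    using assms(2) S by (simp add: elimination_inv_def)
  ultimately show "card {v \<in> free p. lev v \<in> S} \<le> card (S \<inter> {..<n})"
    using assms(3)[OF S] by simp
qed

lemma tightness_nontrivial:
  "k < n \<Longrightarrow> tightness p k d \<noteq> 0 \<Longrightarrow> k \<notin> free p"
  by (auto simp: tightness_def free_def split: if_splits)

section \<open>Moving along a kernel direction\<close>

text \<open>Preserved ones keep the leaves covered; preserved zeros keep the root and the levels up
  to \<open>h\<close> out of the result.\<close>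

definition improves :: "(nat \<Rightarrow> real) \<Rightarrow> (nat \<Rightarrow> real) \<Rightarrow> bool" where
  "improves p p' \<longleftrightarrow>
     potential p' \<and> (\<forall>l. level_load l p' = level_load l p) \<and>
     (\<forall>v<n. (p v = 1 \<longrightarrow> p' v = 1) \<and> (p v = 0 \<longrightarrow> p' v = 0)) \<and> free p' \<subseteq> free p"

lemma improves_refl: "potential p \<Longrightarrow> improves p p"
  by (simp add: improves_def)

lemma improves_trans: "improves p p' \<Longrightarrow> improves p' p'' \<Longrightarrow> improves p p''"
  by (auto simp: improves_def)

text \<open>The ratio test of the simplex method; the last clause makes the step long enough for
  some inequality to become tight.\<close>

definition maximal_step :: "(nat \<Rightarrow> real) \<Rightarrow> (nat \<Rightarrow> real) \<Rightarrow> real \<Rightarrow> bool" where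
  "maximal_step p d t \<longleftrightarrow>
     (\<forall>v<n. d v - d (ep v) < 0 \<longrightarrow> t \<le> (p v - p (ep v)) / (d (ep v) - d v)) \<and>
     (\<forall>v<n. 0 < d v \<longrightarrow> t \<le> (1 - p v) / d v) \<and>
     (\<exists>v<n. d v - d (ep v) < 0 \<and> t = (p v - p (ep v)) / (d (ep v) - d v) \<or>
            0 < d v \<and> t = (1 - p v) / d v)"

text \<open>The kernel condition gives \<open>d v = 0\<close> at values 0 and 1 by climbing through
  vertices of equal value. Strictness is the delicate part: the vertex that becomes tight need not
  have been free, so the lost free vertex may lie further up.\<close>

lemma improves_step:
  assumes p: "potential p"
    and d: "d n = 0" "\<And>k. k < n \<Longrightarrow> tightness p k d = 0" "\<And>l. l < n \<Longrightarrow> level_load l d = 0"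
    and lev: "\<And>v. v < n \<Longrightarrow> lev v < n"
    and t: "maximal_step p d t"
    and p': "\<And>v. v \<le> n \<Longrightarrow> p' v = p v + t * d v"
  shows "improves p p'" and "free p' \<subset> free p"
proof -
  have mono: "p (ep v) \<le> p v" "p v \<le> 1" if "v < n" for v
    using p that by (auto simp: potential_def)
  have pn: "p n = 0" using p by (simp add: potential_def)
  have eq: "d v = d (ep v)" if "v < n" "p v \<le> p (ep v)" for v
    using d(2)[OF that(1)] that(2) by (simp add: tightness_def)
  have one: "d v = 0" if "v < n" "p v = 1" for v
    using that
  proof (induction v rule: forest_induct)
    case (top v)
    then show ?case using d(2)[of v] pn by (simp add: tightness_def)
  next
    case (step v)
    then show ?case using d(2)[of v] eq[of v] mono[of "ep v"] by (auto simp: tightness_def split: if_splits)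
  qed
  have zero: "d v = 0" if "v < n" "p v = 0" for v
    using that
  proof (induction v rule: forest_induct)
    case (top v)
    then show ?case using eq[of v] pn d(1) by simp
  next
    case (step v)
    then have "p (ep v) = 0"
      using mono(1)[of v] potential_nonneg[OF p, of "ep v"] by simp
    then show ?case using step eq[of v] by simp
  qed
  have t0: "0 \<le> t"
    using t mono by (auto simp: maximal_step_def intro!: divide_nonneg_pos)
  have p'_ep: "p' (ep v) = p (ep v) + t * d (ep v)" if "v < n" for v
    using p' ep_le that by blast
  have mono': "p' (ep v) \<le> p' v" if v: "v < n" for v
  proof (cases "d v - d (ep v) < 0")
    case True
    then have "t \<le> (p v - p (ep v)) / (d (ep v) - d v)" using t v by (auto simp: maximal_step_def)
    then have "t * (d (ep v) - d v) \<le> p v - p (ep v)" using True by (simp add: pos_le_divide_eq)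
    then show ?thesis using v p' p'_ep by (simp add: algebra_simps)
  next
    case False
    then have "0 \<le> t * (d v - d (ep v))" using t0 by simp
    then show ?thesis using mono(1)[OF v] v p' p'_ep by (simp add: algebra_simps)
  qed
  have le1': "p' v \<le> 1" if v: "v < n" for v
  proof (cases "0 < d v")
    case True
    then have "t \<le> (1 - p v) / d v" using t v by (auto simp: maximal_step_def)
    then show ?thesis using True v p' by (simp add: pos_le_divide_eq)
  next
    case False
    then have "t * d v \<le> 0" using t0 by (simp add: mult_nonneg_nonpos)
    then show ?thesis using mono(2)[OF v] v p' by simp
  qed
  have sub: "free p' \<subseteq> free p"
  proof
    fix v assume v: "v \<in> free p'"
    then have "v < n" by (simp add: free_def)
    moreover have "p (ep v) < p v"
      using v eq[of v] p' p'_ep by (force simp: free_def)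
    moreover have "p v \<noteq> 1" using v one[of v] p' by (auto simp: free_def)
    ultimately show "v \<in> free p" using mono(2)[of v] by (auto simp: free_def)
  qed
  have "level_load l p' = level_load l p + t * level_load l d" for l
    unfolding level_load_def sum_distrib_left sum.distrib[symmetric]
    using p' p'_ep by (auto intro!: sum.cong simp: algebra_simps)
  moreover have "level_load l d = 0" if "\<not> l < n" for l
    using lev that unfolding level_load_def by (intro sum.neutral) auto
  ultimately have "level_load l p' = level_load l p" for l
    using d(3) by (cases "l < n") auto
  then show "improves p p'"
    using mono' le1' sub p' one zero pn d(1) by (auto simp: improves_def potential_def)
  \<comment> \<open>A vertex tied to its parent moves with it, so the parent reaches 1 as well. The
    climb ends at a vertex strictly above its parent, which is free before and full after the
    step.\<close>
  have reach1: "\<exists>w. w \<in> free p \<and> w \<notin> free p'" if "v < n" "0 < d v" "p' v = 1" for v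
    using that
  proof (induction v rule: forest_induct)
    case (top v)
    then have "p (ep v) < p v" using eq[of v] d(1) by force
    moreover have "p v < 1" using one[of v] top mono(2)[of v] by force
    ultimately show ?case using top by (auto simp: free_def)
  next
    case (step v)
    show ?case
    proof (cases "p v \<le> p (ep v)")
      case True
      then have "p (ep v) = p v" using mono step by force
      then have "0 < d (ep v)" "p' (ep v) = 1"
        using eq[of v] True step p'_ep p' by auto
      then show ?thesis using step.IH by simp
    next
      case False
      moreover have "p v < 1" using one[of v] step mono(2)[of v] by force
      ultimately show ?thesis using step by (auto simp: free_def)
    qed
  qed
  have "\<exists>w. w \<in> free p \<and> w \<notin> free p'"
  proof -
    from t consider
      (merge) v where "v < n" "d v - d (ep v) < 0" "t = (p v - p (ep v)) / (d (ep v) - d v)"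
    | (full) v where "v < n" "0 < d v" "t = (1 - p v) / d v"
      unfolding maximal_step_def by blast
    then show ?thesis
    proof cases
      case full
      then show ?thesis using reach1[of v] p'[of v] by simp
    next
      case merge
      then have "t * (d (ep v) - d v) = p v - p (ep v)" by simp
      moreover have "p' v = p v + t * d v" "p' (ep v) = p (ep v) + t * d (ep v)"
        using merge(1) p' p'_ep by auto
      ultimately have same: "p' v = p' (ep v)" by (simp add: algebra_simps)
      have lt: "p (ep v) < p v" using eq[of v] merge by force
      show ?thesis
      proof (cases "p v = 1")
        \<comment> \<open>A vertex of value 1 is not free and stays at 1; merging with it means that
          its parent rises to 1, so the argument passes to the parent.\<close>
        case True
        then have "d v = 0" "p' v = 1" using one merge p' by auto
        then have "0 < d (ep v)" "p' (ep v) = 1" using merge same by auto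
        moreover have "ep v < n" using calculation d(1) merge ep_le by (metis le_neq_implies_less less_irrefl)
        ultimately show ?thesis using reach1 by blast
      next
        case False
        then have "v \<in> free p" using lt merge mono by (force simp: free_def)
        moreover have "v \<notin> free p'" using same by (simp add: free_def)
        ultimately show ?thesis by blast
      qed
    qed
  qed
  with sub show "free p' \<subset> free p" by blast
qed

lemma balanced_mono:
  assumes "balanced p" "free p' \<subseteq> free p"
  shows "balanced p'"
proof -
  have "card {v \<in> free p'. lev v \<in> S} \<le> card {v \<in> free p. lev v \<in> S}" for S
    using assms(2) by (intro card_mono) auto
  with assms(1) show ?thesis
    unfolding balanced_def by (meson order_trans)
qed

lemma card_tops_le:
  assumes p: "potential p" and bal: "balanced p" and S: "closed_levels S" "l \<in> S"
  shows "card {v. v < n \<and> lev v = l \<and> 0 < p v \<and> p (ep v) \<le> 0}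
    \<le> level_load l p + card (S \<inter> {..<n})"
proof -
  let ?T = "{v. v < n \<and> lev v = l \<and> 0 < p v \<and> p (ep v) \<le> 0}"
  let ?O = "{v \<in> ?T. p v = 1}" and ?F = "{v \<in> free p. lev v \<in> S}"
  have mono: "p (ep v) \<le> p v" "p v \<le> 1" if "v < n" for v
    using p that by (auto simp: potential_def)
  have nonneg: "0 \<le> p (ep v)" if "v < n" for v
    using that p potential_nonneg[OF p] by (cases rule: ep_cases) (auto simp: potential_def)
  have "?T \<subseteq> ?O \<union> ?F"
    using S mono by (force simp: free_def)
  then have "card ?T \<le> card (?O \<union> ?F)" by (intro card_mono) auto
  also have "\<dots> \<le> card ?O + card ?F" by (rule card_Un_le)
  also have "card ?F \<le> card (S \<inter> {..<n})" using bal S by (simp add: balanced_def)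
  finally have "card ?T \<le> card ?O + card (S \<inter> {..<n})" by simp
  moreover have "real (card ?O) \<le> level_load l p"
  proof -
    have "(\<Sum>v\<in>?O. p v - p (ep v)) = (\<Sum>v\<in>?O. 1)"
      by (rule sum.cong) (use nonneg in force)+
    then have "real (card ?O) = (\<Sum>v\<in>?O. p v - p (ep v))" by simp
    also have "\<dots> \<le> level_load l p"
      unfolding level_load_def using mono by (intro sum_mono2) auto
    finally show ?thesis .
  qed
  ultimately show ?thesis by linarith
qed

end

section \<open>Rounding as a program\<close>

abbreviation nget :: "string \<Rightarrow> nexp \<Rightarrow> nexp" where
  "nget a i \<equiv> NGet a i (NConst 0)"

abbreviation rget :: "string \<Rightarrow> nexp \<Rightarrow> rexp" where
  "rget a i \<equiv> RGet a i (NConst 0)"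

abbreviation nset :: "string \<Rightarrow> nexp \<Rightarrow> nexp \<Rightarrow> com" where
  "nset a i e \<equiv> NSet a i (NConst 0) e"

abbreviation rset :: "string \<Rightarrow> nexp \<Rightarrow> rexp \<Rightarrow> com" where
  "rset a i e \<equiv> RSet a i (NConst 0) e"

abbreviation "vi \<equiv> nvar ''i''"
abbreviation "vj \<equiv> nvar ''j''"
abbreviation "vk \<equiv> nvar ''k''"
abbreviation "pivot \<equiv> nvar ''pivot''"
abbreviation "rconst k \<equiv> ROfNat (NConst k)"
abbreviation "NEq d e \<equiv> Conj (NLe d e) (NLe e d)"
abbreviation "NLess d e \<equiv> NLe (NAdd d (NConst 1)) e"
abbreviation "RLess d e \<equiv> Neg (RLe e d)"

section \<open>Pivot steps on the direction matrix\<close>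

text \<open>The value \<open>n\<close> signals that no pivot exists; any alive index with nonzero
  row value will do.\<close>

definition find_pivot :: com where
  "find_pivot =
     Seq (nset ''pivot'' (NConst 0) (nvar ''n''))
       (loop ''i'' (If (Conj (NLe (NConst 1) (nget ''alive'' vi))
                          (Neg (Conj (RLe (rget ''val'' vi) (rconst 0)) (RLe (rconst 0) (rget ''val'' vi)))))
                     (nset ''pivot'' (NConst 0) vi) Skip))"

definition reduce_row :: com where
  "reduce_row =
     loop ''j'' (RSet ''D'' vi vj
       (RSub (RGet ''D'' vi vj)
         (RMul (RDiv (rget ''val'' vi) (rget ''val'' pivot)) (RGet ''D'' pivot vj))))"

definition reduce_rows :: com where
  "reduce_rows = loop ''i'' (If (NLe (NConst 1) (nget ''alive'' vi)) reduce_row Skip)"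

text \<open>Clearing the flag of the pivot first keeps \<open>reduce_rows\<close> from overwriting
  the pivot row, which it still has to read for the other rows.\<close>

definition eliminate :: com where
  "eliminate =
     Seq find_pivot
       (If (NLess pivot (nvar ''n''))
         (Seq (nset ''alive'' pivot (NConst 0)) reduce_rows) Skip)"

lemma writes_reduce [simp]:
  "nwrites find_pivot = {''i'', ''pivot''}" "rwrites find_pivot = {}"
  "nwrites reduce_row = {''j''}" "rwrites reduce_row = {''D''}"
  "nwrites reduce_rows = {''i'', ''j''}" "rwrites reduce_rows = {''D''}"
  "nwrites eliminate = {''i'', ''j'', ''pivot'', ''alive''}" "rwrites eliminate = {''D''}"
  by (auto simp: find_pivot_def reduce_row_def reduce_rows_def eliminate_def)

lemma find_pivot:
  assumes n: "nats s ''n'' 0 0 = n"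
    and s': "s' = run find_pivot s"
  shows "nats s' ''pivot'' 0 0 < n \<and> nats s ''alive'' (nats s' ''pivot'' 0 0) 0 \<noteq> 0 \<and>
      reals s ''val'' (nats s' ''pivot'' 0 0) 0 \<noteq> 0 \<or>
    nats s' ''pivot'' 0 0 = n \<and> (\<forall>i<n. nats s ''alive'' i 0 \<noteq> 0 \<longrightarrow> reals s ''val'' i 0 = 0)"
proof -
  define Inv where "Inv = (\<lambda>k (t :: store). let q = nats t ''pivot'' 0 0 in
     q < n \<and> nats s ''alive'' q 0 \<noteq> 0 \<and> reals s ''val'' q 0 \<noteq> 0 \<or>
     q = n \<and> (\<forall>i<k. nats s ''alive'' i 0 \<noteq> 0 \<longrightarrow> reals s ''val'' i 0 = 0))"
  have "Inv n (run find_pivot s)"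
    unfolding find_pivot_def run.simps(4)
  proof (rule run_loop, goal_cases)
    case (3 k t)
    have "nats t ''alive'' = nats s ''alive''" "reals t ''val'' = reals s ''val''"
      by (simp_all add: 3)
    then show ?case
      using 3(1,2) by (auto simp: Inv_def Let_def less_Suc_eq)
  qed (use n in \<open>auto simp: Inv_def\<close>)
  then show ?thesis using n by (simp add: Inv_def Let_def s')
qed


lemma reduce_row:
  assumes n: "nats s ''n'' 0 0 = n"
    and i: "nats s ''i'' 0 0 = i" and q: "nats s ''pivot'' 0 0 = q" "i \<noteq> q"
  shows "reals (run reduce_row s) ''D'' k v =
    (if k = i \<and> v < n then reals s ''D'' i v - reals s ''val'' i 0 / reals s ''val'' q 0 * reals s ''D'' q v
     else reals s ''D'' k v)"
proof -
  define Inv where "Inv = (\<lambda>m (t :: store). \<forall>k v. reals t ''D'' k v =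
    (if k = i \<and> v < m then reals s ''D'' i v - reals s ''val'' i 0 / reals s ''val'' q 0 * reals s ''D'' q v
     else reals s ''D'' k v))"
  have "Inv n (run reduce_row s)"
    unfolding reduce_row_def
  proof (rule run_loop, goal_cases)
    case (3 m t)
    have "nats t ''i'' = nats s ''i''" "nats t ''pivot'' = nats s ''pivot''" "reals t ''val'' = reals s ''val''"
      by (simp_all add: 3)
    then show ?case
      using 3(1,2) i q by (auto simp: Inv_def less_Suc_eq)
  qed (use n in \<open>auto simp: Inv_def\<close>)
  then show ?thesis by (simp add: Inv_def)
qed

lemma reduce_rows:
  assumes n: "nats s ''n'' 0 0 = n"
    and q: "nats s ''pivot'' 0 0 = q" "nats s ''alive'' q 0 = 0"
  shows "reals (run reduce_rows s) ''D'' k v =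
    (if k < n \<and> nats s ''alive'' k 0 \<noteq> 0 \<and> v < n
     then reals s ''D'' k v - reals s ''val'' k 0 / reals s ''val'' q 0 * reals s ''D'' q v
     else reals s ''D'' k v)"
proof -
  define Inv where "Inv = (\<lambda>m (t :: store). \<forall>k v. reals t ''D'' k v =
    (if k < m \<and> nats s ''alive'' k 0 \<noteq> 0 \<and> v < n
     then reals s ''D'' k v - reals s ''val'' k 0 / reals s ''val'' q 0 * reals s ''D'' q v
     else reals s ''D'' k v))"
  have "Inv n (run reduce_rows s)"
    unfolding reduce_rows_def
  proof (rule run_loop, goal_cases)
    case (3 m t)
    have t: "nats t ''n'' = nats s ''n''" "nats t ''alive'' = nats s ''alive''"
      "nats t ''pivot'' = nats s ''pivot''" "reals t ''val'' = reals s ''val''"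
      by (simp_all add: 3)
    show ?case
    proof (cases "nats s ''alive'' m 0 = 0")
      case True
      then show ?thesis using 3(1,2) t by (auto simp: Inv_def less_Suc_eq)
    next
      case False
      with q have "m \<noteq> q" by auto
      then have "reals (run reduce_row (put_nat ''i'' 0 0 m t)) ''D'' k v =
        (if k = m \<and> v < n
         then reals t ''D'' m v - reals s ''val'' m 0 / reals s ''val'' q 0 * reals t ''D'' q v
         else reals t ''D'' k v)" for k v
        using reduce_row[of "put_nat ''i'' 0 0 m t" n m q k v] n q t by simp
      then show ?thesis using 3(1,2) t q False by (auto simp: Inv_def less_Suc_eq)
    qed
  qed (use n in \<open>auto simp: Inv_def\<close>)
  then show ?thesis by (simp add: Inv_def)
qed

definition (in layered_forest) agrees :: "store \<Rightarrow> bool" where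
  "agrees s \<longleftrightarrow> nats s ''n'' 0 0 = n \<and>
     (\<forall>v<n. nats s ''lev'' v 0 = lev v \<and> nats s ''ep'' v 0 = ep v)"

definition alive_set :: "nat \<Rightarrow> store \<Rightarrow> nat set" where
  "alive_set n s = {i. i < n \<and> nats s ''alive'' i 0 \<noteq> 0}"

text \<open>The dummy column \<open>n\<close> is never written. As it is zero, the update formula of
  \<open>pivot_step\<close> holds there too.\<close>

lemma (in layered_forest) eliminate:
  assumes n: "nats s ''n'' 0 0 = n"
    and Dn: "\<And>i. reals s ''D'' i n = 0"
    and val: "\<And>i. i < n \<Longrightarrow> reals s ''val'' i 0 = f (reals s ''D'' i)"
    and s': "s' = run eliminate s"
  shows "pivot_step f (alive_set n s) (reals s ''D'') (alive_set n s') (reals s' ''D'')"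
    and "\<And>i. reals s' ''D'' i n = 0"
proof -
  define t where "t = run find_pivot s"
  define q where "q = nats t ''pivot'' 0 0"
  have t: "nats t ''n'' = nats s ''n''" "nats t ''alive'' = nats s ''alive''"
      "reals t = reals s"
    by (auto simp: t_def nats_frame reals_frame)
  note fp = find_pivot[OF n t_def, folded q_def]
  show D'n: "reals s' ''D'' i n = 0" for i
  proof (cases "q < n")
    case True
    let ?u = "put_nat ''alive'' q 0 0 t"
    have "s' = run reduce_rows ?u"
      using True n t by (simp add: s' eliminate_def t_def[symmetric] q_def[symmetric])
    then show ?thesis
      using reduce_rows[of ?u n q i n] n t Dn by (simp add: q_def)
  next
    case False
    then show ?thesis using n t Dn by (simp add: s' eliminate_def t_def[symmetric] q_def[symmetric])
  qed
  show "pivot_step f (alive_set n s) (reals s ''D'') (alive_set n s') (reals s' ''D'')"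
  proof (cases "q < n")
    case True
    with fp have q: "nats s ''alive'' q 0 \<noteq> 0" "reals s ''val'' q 0 \<noteq> 0" by auto
    let ?u = "put_nat ''alive'' q 0 0 t"
    have s'_eq: "s' = run reduce_rows ?u"
      using True n t by (simp add: s' eliminate_def t_def[symmetric] q_def[symmetric])
    have A: "alive_set n s' = alive_set n s - {q}"
      using t by (auto simp: s'_eq nats_frame alive_set_def)
    have "reals s' ''D'' i v = reals s ''D'' i v - f (reals s ''D'' i) / f (reals s ''D'' q) * reals s ''D'' q v"
      if i: "i \<in> alive_set n s'" and v: "v \<le> n" for i v
    proof (cases "v < n")
      case v': True
      have "i < n" "i \<noteq> q" "nats s ''alive'' i 0 \<noteq> 0" using i A by (auto simp: alive_set_def)
      then show ?thesis
        using reduce_rows[of ?u n q i v] n t v' val True by (simp add: q_def s'_eq)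
    next
      case False
      then show ?thesis using v D'n Dn by simp
    qed
    then show ?thesis
      unfolding pivot_step_def using A True q val by (intro disjI2 bexI[of _ q]) (auto simp: alive_set_def)
  next
    case False
    then have s'_eq: "s' = t" using n t by (simp add: s' eliminate_def t_def[symmetric] q_def[symmetric])
    show ?thesis
      unfolding pivot_step_def using fp False val t
      by (intro disjI1) (auto simp: alive_set_def s'_eq)
  qed
qed

section \<open>The rounding loop\<close>

definition init_dir :: com where
  "init_dir =
     loop ''j'' (If (NEq vi vj) (RSet ''D'' vi vj (rconst 1)) (RSet ''D'' vi vj (rconst 0)))"

definition init_dirs :: com where
  "init_dirs = loop ''i'' (Seq (nset ''alive'' vi (NConst 1)) init_dir)"

definition tightness_vals :: com where
  "tightness_vals = loop ''i''
     (If (RLe (rget ''p'' vk) (rget ''p'' (nget ''ep'' vk)))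
       (rset ''val'' vi (RSub (RGet ''D'' vi vk) (RGet ''D'' vi (nget ''ep'' vk))))
       (If (RLe (rconst 1) (rget ''p'' vk)) (rset ''val'' vi (RGet ''D'' vi vk))
         (rset ''val'' vi (rconst 0))))"

definition load_val :: com where
  "load_val = loop ''j'' (If (NEq (nget ''lev'' vj) vk)
       (rset ''val'' vi (RAdd (rget ''val'' vi)
          (RSub (RGet ''D'' vi vj) (RGet ''D'' vi (nget ''ep'' vj))))) Skip)"

definition load_vals :: com where
  "load_vals = loop ''i'' (Seq (rset ''val'' vi (rconst 0)) load_val)"

definition tightness_rows :: com where
  "tightness_rows = loop ''k'' (Seq tightness_vals eliminate)"

definition load_rows :: com where
  "load_rows = loop ''k'' (Seq load_vals eliminate)"

definition find_alive :: com where
  "find_alive = Seq (nset ''pivot'' (NConst 0) (nvar ''n''))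
     (loop ''i'' (If (NLe (NConst 1) (nget ''alive'' vi)) (nset ''pivot'' (NConst 0) vi) Skip))"

abbreviation rvar :: "string \<Rightarrow> rexp" where
  "rvar a \<equiv> rget a (NConst 0)"

definition lower_step :: "rexp \<Rightarrow> com" where
  "lower_step e = If (RLe e (rvar ''t'')) (rset ''t'' (NConst 0) e) Skip"

text \<open>The start value \<open>1 - p q\<close> at the pivot \<open>q\<close> is already one of
  the ratios because the direction is 1 there, so the minimum needs no infinite initial
  value.\<close>

definition step_size :: com where
  "step_size = Seq (rset ''t'' (NConst 0) (RSub (rconst 1) (rget ''p'' pivot)))
     (loop ''j''
       (Seq (If (RLess (RSub (RGet ''D'' pivot vj) (RGet ''D'' pivot (nget ''ep'' vj))) (rconst 0))
               (lower_step (RDiv (RSub (rget ''p'' vj) (rget ''p'' (nget ''ep'' vj)))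
                 (RSub (RGet ''D'' pivot (nget ''ep'' vj)) (RGet ''D'' pivot vj)))) Skip)
            (If (RLess (rconst 0) (RGet ''D'' pivot vj))
               (lower_step (RDiv (RSub (rconst 1) (rget ''p'' vj)) (RGet ''D'' pivot vj))) Skip)))"

definition shift :: com where
  "shift = loop ''j'' (rset ''p'' vj
     (RAdd (rget ''p'' vj) (RMul (rvar ''t'') (RGet ''D'' pivot vj))))"

definition move :: com where
  "move = Seq find_alive (If (NLess pivot (nvar ''n'')) (Seq step_size shift) Skip)"

definition round_step :: com where
  "round_step = Seq init_dirs (Seq tightness_rows (Seq load_rows move))"

definition round_potential :: com where
  "round_potential = loop ''m'' round_step"

lemma writes_round [simp]:
  "nwrites init_dir = {''j''}" "rwrites init_dir = {''D''}"
  "nwrites init_dirs = {''i'', ''j'', ''alive''}" "rwrites init_dirs = {''D''}"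
  "nwrites tightness_vals = {''i''}" "rwrites tightness_vals = {''val''}"
  "nwrites load_val = {''j''}" "rwrites load_val = {''val''}"
  "nwrites load_vals = {''i'', ''j''}" "rwrites load_vals = {''val''}"
  "nwrites tightness_rows = {''i'', ''j'', ''k'', ''pivot'', ''alive''}" "rwrites tightness_rows = {''D'', ''val''}"
  "nwrites load_rows = {''i'', ''j'', ''k'', ''pivot'', ''alive''}" "rwrites load_rows = {''D'', ''val''}"
  "nwrites find_alive = {''i'', ''pivot''}" "rwrites find_alive = {}"
  "nwrites (lower_step e) = {}" "rwrites (lower_step e) = {''t''}"
  "nwrites step_size = {''j''}" "rwrites step_size = {''t''}"
  "nwrites shift = {''j''}" "rwrites shift = {''p''}"
  "nwrites move = {''i'', ''j'', ''pivot''}" "rwrites move = {''t'', ''p''}"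
  "nwrites round_step = {''i'', ''j'', ''k'', ''pivot'', ''alive''}" "rwrites round_step = {''D'', ''val'', ''t'', ''p''}"
  "nwrites round_potential = {''i'', ''j'', ''k'', ''m'', ''pivot'', ''alive''}"
  "rwrites round_potential = {''D'', ''val'', ''t'', ''p''}"
  by (auto simp: init_dir_def init_dirs_def tightness_vals_def load_val_def load_vals_def tightness_rows_def
      load_rows_def find_alive_def lower_step_def step_size_def shift_def move_def round_step_def
      round_potential_def)

definition pot :: "store \<Rightarrow> nat \<Rightarrow> real" where
  "pot s v = reals s ''p'' v 0"

lemma init_dir:
  assumes n: "nats s ''n'' 0 0 = n" and i: "nats s ''i'' 0 0 = i"
  shows "reals (run init_dir s) ''D'' k v =
    (if k = i \<and> v < n then of_bool (v = k) else reals s ''D'' k v)"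
proof -
  define Inv where "Inv = (\<lambda>m (t :: store). \<forall>k v. reals t ''D'' k v =
    (if k = i \<and> v < m then of_bool (v = k) else reals s ''D'' k v))"
  have "Inv n (run init_dir s)"
    unfolding init_dir_def
  proof (rule run_loop, goal_cases)
    case (3 m t)
    have "nats t ''i'' = nats s ''i''" by (simp add: 3)
    then show ?case using 3(1,2) i by (auto simp: Inv_def less_Suc_eq)
  qed (use n in \<open>auto simp: Inv_def\<close>)
  then show ?thesis by (simp add: Inv_def)
qed

lemma init_dirs:
  assumes n: "nats s ''n'' 0 0 = n" and s': "s' = run init_dirs s"
  shows "alive_set n s' = {..<n}"
    and "i < n \<Longrightarrow> v < n \<Longrightarrow> reals s' ''D'' i v = of_bool (v = i)"
    and "reals s' ''D'' i n = reals s ''D'' i n"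
proof -
  define Inv where "Inv = (\<lambda>m (t :: store). (\<forall>i<m. nats t ''alive'' i 0 = 1) \<and>
    (\<forall>i v. reals t ''D'' i v = (if i < m \<and> v < n then of_bool (v = i) else reals s ''D'' i v)))"
  have "Inv n (run init_dirs s)"
    unfolding init_dirs_def
  proof (rule run_loop, goal_cases)
    case (3 m t)
    let ?u = "put_nat ''alive'' m 0 1 (put_nat ''i'' 0 0 m t)"
    have "nats ?u ''n'' 0 0 = n" "nats ?u ''i'' 0 0 = m" using 3(3)[of "''n''"] n by simp_all
    note init_dir[OF this]
    then show ?case using 3(1,2) by (auto simp: Inv_def less_Suc_eq nats_frame)
  qed (use n in \<open>auto simp: Inv_def\<close>)
  then show "alive_set n s' = {..<n}"
    and "i < n \<Longrightarrow> v < n \<Longrightarrow> reals s' ''D'' i v = of_bool (v = i)"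
    and "reals s' ''D'' i n = reals s ''D'' i n"
    by (auto simp: Inv_def s' alive_set_def)
qed

lemma find_alive:
  assumes n: "nats s ''n'' 0 0 = n"
  shows "let q = nats (run find_alive s) ''pivot'' 0 0 in
    q \<in> alive_set n s \<or> q = n \<and> alive_set n s = {}"
proof -
  define Inv where "Inv = (\<lambda>k (t :: store). let q = nats t ''pivot'' 0 0 in
     q \<in> alive_set n s \<or> q = n \<and> (\<forall>i<k. nats s ''alive'' i 0 = 0))"
  have "Inv n (run find_alive s)"
    unfolding find_alive_def run.simps(4)
  proof (rule run_loop, goal_cases)
    case (3 k t)
    have "nats t ''alive'' = nats s ''alive''" by (simp add: 3)
    then show ?case
      using 3(1,2) by (auto simp: Inv_def Let_def less_Suc_eq alive_set_def)
  qed (use n in \<open>auto simp: Inv_def\<close>)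
  then show ?thesis by (auto simp: Inv_def Let_def alive_set_def)
qed

lemma shift:
  assumes n: "nats s ''n'' 0 0 = n"
  shows "pot (run shift s) v = (if v < n then pot s v + reals s ''t'' 0 0 *
    reals s ''D'' (nats s ''pivot'' 0 0) v else pot s v)"
proof -
  define Inv where "Inv = (\<lambda>k (t :: store). \<forall>v. reals t ''p'' v 0 =
    (if v < k then reals s ''p'' v 0 + reals s ''t'' 0 0 * reals s ''D'' (nats s ''pivot'' 0 0) v
     else reals s ''p'' v 0))"
  have "Inv n (run shift s)"
    unfolding shift_def
  proof (rule run_loop, goal_cases)
    case (3 k t)
    have "nats t ''pivot'' = nats s ''pivot''" "reals t ''D'' = reals s ''D''" "reals t ''t'' = reals s ''t''"
      by (simp_all add: 3)
    then show ?case using 3(1,2) by (auto simp: Inv_def less_Suc_eq)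
  qed (use n in \<open>auto simp: Inv_def\<close>)
  then show ?thesis by (simp add: Inv_def pot_def)
qed

context layered_forest
begin

lemma agreesD:
  assumes "agrees s"
  shows "nats s ''n'' 0 0 = n" "v < n \<Longrightarrow> nats s ''lev'' v 0 = lev v" "v < n \<Longrightarrow> nats s ''ep'' v 0 = ep v"
  using assms by (auto simp: agrees_def)

lemma agrees_cong:
  "nats t ''n'' = nats s ''n'' \<Longrightarrow> nats t ''lev'' = nats s ''lev'' \<Longrightarrow> nats t ''ep'' = nats s ''ep'' \<Longrightarrow>
   agrees t = agrees s"
  by (simp add: agrees_def)

lemma tightness_vals:
  assumes s: "agrees s" and k: "nats s ''k'' 0 0 = k" "k < n" and i: "i < n"
  shows "reals (run tightness_vals s) ''val'' i 0 = tightness (pot s) k (reals s ''D'' i)"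
proof -
  define Inv where "Inv = (\<lambda>m (t :: store). \<forall>i<m. reals t ''val'' i 0 = tightness (pot s) k (reals s ''D'' i))"
  have "Inv n (run tightness_vals s)"
    unfolding tightness_vals_def
  proof (rule run_loop, goal_cases)
    case (3 m t)
    have "nats t ''k'' = nats s ''k''" "nats t ''ep'' = nats s ''ep''" "reals t ''D'' = reals s ''D''"
      "reals t ''p'' = reals s ''p''"
      by (simp_all add: 3)
    then show ?case
      using 3(1,2) k agreesD[OF s] by (auto simp: Inv_def less_Suc_eq tightness_def pot_def)
  qed (use agreesD[OF s] in \<open>auto simp: Inv_def\<close>)
  with i show ?thesis by (simp add: Inv_def)
qed

lemma load_val:
  assumes s: "agrees s" and k: "nats s ''k'' 0 0 = k" and i: "nats s ''i'' 0 0 = i"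
  shows "reals (run load_val s) ''val'' l 0 =
    (if l = i then reals s ''val'' i 0 + level_load k (reals s ''D'' i) else reals s ''val'' l 0)"
proof -
  define Inv where "Inv = (\<lambda>m (t :: store). \<forall>l. reals t ''val'' l 0 =
    (if l = i then reals s ''val'' i 0 +
       (\<Sum>v | v < m \<and> lev v = k. reals s ''D'' i v - reals s ''D'' i (ep v)) else reals s ''val'' l 0))"
  have split: "{v. v < Suc m \<and> lev v = k} = {v. v < m \<and> lev v = k} \<union> (if lev m = k then {m} else {})" for m
    by (auto simp: less_Suc_eq)
  have "Inv n (run load_val s)"
    unfolding load_val_def
  proof (rule run_loop, goal_cases)
    case (3 m t)
    have "nats t ''k'' = nats s ''k''" "nats t ''i'' = nats s ''i''" "nats t ''ep'' = nats s ''ep''"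
      "nats t ''lev'' = nats s ''lev''" "reals t ''D'' = reals s ''D''"
      by (simp_all add: 3)
    then show ?case
      using 3(1,2) k i agreesD[OF s] by (auto simp: Inv_def split)
  qed (use agreesD[OF s] in \<open>auto simp: Inv_def\<close>)
  then show ?thesis by (simp add: Inv_def level_load_def)
qed

lemma load_vals:
  assumes s: "agrees s" and k: "nats s ''k'' 0 0 = k" and i: "i < n"
  shows "reals (run load_vals s) ''val'' i 0 = level_load k (reals s ''D'' i)"
proof -
  define Inv where "Inv = (\<lambda>m (t :: store). \<forall>i<m. reals t ''val'' i 0 = level_load k (reals s ''D'' i))"
  have "Inv n (run load_vals s)"
    unfolding load_vals_def
  proof (rule run_loop, goal_cases)
    case (3 m t)
    have t: "nats t ''k'' = nats s ''k''" "nats t ''ep'' = nats s ''ep''" "nats t ''n'' = nats s ''n''"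
      "nats t ''lev'' = nats s ''lev''" "reals t ''D'' = reals s ''D''"
      by (simp_all add: 3)
    let ?u = "put_real ''val'' m 0 0 (put_nat ''i'' 0 0 m t)"
    have u: "agrees ?u" using agrees_cong[of ?u s] s t by simp
    show ?case
      using 3(1,2) load_val[OF u, of k m] t k by (auto simp: Inv_def less_Suc_eq)
  qed (use agreesD[OF s] in \<open>auto simp: Inv_def\<close>)
  with i show ?thesis by (simp add: Inv_def)
qed

lemma step_size:
  assumes s: "agrees s" and q: "nats s ''pivot'' 0 0 = q" "q < n"
    and d: "d = reals s ''D'' q" "d q = 1"
  shows "maximal_step (pot s) d (reals (run step_size s) ''t'' 0 0)"
proof -
  let ?p = "pot s"
  define Inv where "Inv = (\<lambda>m (t :: store). let y = reals t ''t'' 0 0 in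
     (\<forall>v<m. d v - d (ep v) < 0 \<longrightarrow> y \<le> (?p v - ?p (ep v)) / (d (ep v) - d v)) \<and>
     (\<forall>v<m. 0 < d v \<longrightarrow> y \<le> (1 - ?p v) / d v) \<and>
     (\<exists>v<n. d v - d (ep v) < 0 \<and> y = (?p v - ?p (ep v)) / (d (ep v) - d v) \<or>
            0 < d v \<and> y = (1 - ?p v) / d v))"
  have lower: "Inv m (run (lower_step e) t)" if "Inv m t" "rval e t = y"
    "\<exists>v<n. d v - d (ep v) < 0 \<and> y = (?p v - ?p (ep v)) / (d (ep v) - d v) \<or>
            0 < d v \<and> y = (1 - ?p v) / d v" for m e t y
    using that unfolding Inv_def Let_def lower_step_def by (auto intro: order_trans)
  have lower_le: "reals (run (lower_step e) t) ''t'' 0 0 \<le> rval e t"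
    "reals (run (lower_step e) t) ''t'' 0 0 \<le> reals t ''t'' 0 0" for e t
    by (auto simp: lower_step_def)
  have "Inv n (run step_size s)"
    unfolding step_size_def run.simps(4)
  proof (rule run_loop, goal_cases)
    case 2
    then show ?case using q d by (auto simp: Inv_def pot_def Let_def intro!: exI[of _ q])
  next
    case (3 m t)
    define u where "u = put_nat ''j'' 0 0 m t"
    define e1 where "e1 = RDiv (RSub (rget ''p'' vj) (rget ''p'' (nget ''ep'' vj)))
                 (RSub (RGet ''D'' pivot (nget ''ep'' vj)) (RGet ''D'' pivot vj))"
    define e2 where "e2 = RDiv (RSub (rconst 1) (rget ''p'' vj)) (RGet ''D'' pivot vj)"
    define w where "w = (if d m - d (ep m) < 0 then run (lower_step e1) u else u)"
    define z where "z = (if 0 < d m then run (lower_step e2) w else w)"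
    have t: "nats t ''pivot'' = nats s ''pivot''" "nats t ''ep'' = nats s ''ep''"
      "reals t ''D'' = reals s ''D''" "reals t ''p'' = reals s ''p''"
      by (simp_all add: 3)
    have u: "Inv m u" using 3(2) by (simp add: Inv_def u_def)
    have e1: "rval e1 u = (?p m - ?p (ep m)) / (d (ep m) - d m)"
      using t q d 3(1) agreesD[OF s] by (simp add: e1_def u_def pot_def)
    have w: "Inv m w" "d m - d (ep m) < 0 \<Longrightarrow> reals w ''t'' 0 0 \<le> rval e1 u"
      using u lower[OF u e1] 3(1) lower_le(1)[of e1 u] by (auto simp: w_def)
    have wn: "nats w = nats u" "\<And>a. a \<noteq> ''t'' \<Longrightarrow> reals w a = reals u a"
      by (auto simp: w_def nats_frame reals_frame)
    have e2: "rval e2 w = (1 - ?p m) / d m"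
      using t q d 3(1) agreesD[OF s] by (simp add: e2_def wn pot_def) (simp add: u_def t)
    have z: "Inv m z" "0 < d m \<Longrightarrow> reals z ''t'' 0 0 \<le> rval e2 w" "reals z ''t'' 0 0 \<le> reals w ''t'' 0 0"
      using w lower[OF w(1) e2] 3(1) lower_le[of e2 w] by (auto simp: z_def)
    have "Inv (Suc m) z"
      using z w e1 e2 unfolding Inv_def Let_def by (auto simp: less_Suc_eq)
    moreover have "z = run (Seq (If (RLess (RSub (RGet ''D'' pivot vj) (RGet ''D'' pivot (nget ''ep'' vj))) (rconst 0))
               (lower_step e1) Skip)
            (If (RLess (rconst 0) (RGet ''D'' pivot vj))
               (lower_step e2) Skip)) u"
    proof -
      have "w = run (If (RLess (RSub (RGet ''D'' pivot vj) (RGet ''D'' pivot (nget ''ep'' vj))) (rconst 0))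
               (lower_step e1) Skip) u"
        using t q d 3(1) agreesD[OF s] by (simp add: w_def u_def not_le)
      moreover have "z = run (If (RLess (rconst 0) (RGet ''D'' pivot vj)) (lower_step e2) Skip) w"
        using t q d by (simp add: z_def wn not_le) (simp add: u_def t)
      ultimately show ?thesis by simp
    qed
    ultimately show ?case by (simp only: u_def e1_def e2_def)
  qed (use agreesD[OF s] in auto)
  then show ?thesis by (simp add: Inv_def maximal_step_def Let_def)
qed

lemma tightness_rows:
  assumes s: "agrees s" and Dn: "\<And>i. reals s ''D'' i n = 0"
    and inv: "elimination_inv {} (\<lambda>_. 0) (alive_set n s) (reals s ''D'')"
    and s': "s' = run tightness_rows s"
  shows "\<And>i. reals s' ''D'' i n = 0"
    and "elimination_inv (tightness (pot s) ` {..<n})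
      (\<lambda>S. card {k. k < n \<and> k \<notin> free (pot s) \<and> lev k \<in> S}) (alive_set n s') (reals s' ''D'')"
proof -
  let ?p = "pot s"
  define Inv where "Inv = (\<lambda>m (t :: store). (\<forall>i. reals t ''D'' i n = 0) \<and>
    elimination_inv (tightness ?p ` {..<m})
      (\<lambda>S. card {k. k < m \<and> k \<notin> free ?p \<and> lev k \<in> S}) (alive_set n t) (reals t ''D''))"
  have "Inv n (run tightness_rows s)"
    unfolding tightness_rows_def
  proof (rule run_loop, goal_cases)
    case (3 m t)
    have t: "nats t ''n'' = nats s ''n''" "nats t ''lev'' = nats s ''lev''"
      "nats t ''ep'' = nats s ''ep''" "reals t ''p'' = reals s ''p''"
      by (simp_all add: 3)
    define u where "u = put_nat ''k'' 0 0 m t"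
    define w where "w = run tightness_vals u"
    have u: "agrees u" "nats u ''k'' 0 0 = m" "pot u = ?p"
      using agrees_cong[of u s] s t by (auto simp: u_def pot_def[abs_def])
    have w: "nats w ''n'' 0 0 = n" "reals w ''D'' = reals t ''D''" "alive_set n w = alive_set n t"
      using t agreesD[OF s] by (auto simp: w_def u_def nats_frame reals_frame alive_set_def)
    have val: "reals w ''val'' i 0 = tightness ?p m (reals w ''D'' i)" if "i < n" for i
      using tightness_vals[OF u(1,2) 3(1) that] w by (simp add: w_def u_def[symmetric] u(3)) (simp add: u_def)
    have "\<forall>i. reals w ''D'' i n = 0" using 3(2) w by (simp add: Inv_def)
    note el = eliminate[OF w(1) _ val refl, OF this[rule_format]]
    have "elimination_inv (insert (tightness ?p m) (tightness ?p ` {..<m}))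
      (\<lambda>S. card {k. k < Suc m \<and> k \<notin> free ?p \<and> lev k \<in> S})
      (alive_set n (run eliminate w)) (reals (run eliminate w) ''D'')"
    proof (rule elimination_inv_step[OF _ el(1) _ local_tightness[OF 3(1)]])
      show "elimination_inv (tightness ?p ` {..<m})
          (\<lambda>S. card {k. k < m \<and> k \<notin> free ?p \<and> lev k \<in> S}) (alive_set n w) (reals w ''D'')"
        using 3(2) w by (simp add: Inv_def)
      show "linear_row g" if "g \<in> insert (tightness ?p m) (tightness ?p ` {..<m})" for g
        using that 3(1) linear_tightness by auto
      \<comment> \<open>The row of a free vertex is identically zero, so only non-free vertices
        enter the count.\<close>
      show "card {k. k < m \<and> k \<notin> free ?p \<and> lev k \<in> S} +
          of_bool (lev m \<in> S \<and> (\<exists>d. tightness ?p m d \<noteq> 0))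
        \<le> card {k. k < Suc m \<and> k \<notin> free ?p \<and> lev k \<in> S}" for S
      proof (cases "lev m \<in> S \<and> (\<exists>d. tightness ?p m d \<noteq> 0)")
        case True
        then have "{k. k < Suc m \<and> k \<notin> free ?p \<and> lev k \<in> S} =
            insert m {k. k < m \<and> k \<notin> free ?p \<and> lev k \<in> S}"
          using tightness_nontrivial[OF 3(1)] by (auto simp: less_Suc_eq)
        then show ?thesis using True by simp
      next
        case False
        then have "of_bool (lev m \<in> S \<and> (\<exists>d. tightness ?p m d \<noteq> 0)) = (0 :: nat)" by auto
        then show ?thesis by (auto intro!: card_mono)
      qed
    qed
    then show ?case
      using el(2) by (simp add: Inv_def lessThan_Suc w_def u_def)
  qed (use agreesD[OF s] Dn inv in \<open>auto simp: Inv_def\<close>)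
  then show "\<And>i. reals s' ''D'' i n = 0"
    and "elimination_inv (tightness (pot s) ` {..<n})
      (\<lambda>S. card {k. k < n \<and> k \<notin> free (pot s) \<and> lev k \<in> S}) (alive_set n s') (reals s' ''D'')"
    by (auto simp: Inv_def s')
qed

text \<open>Continues an elimination already carried out for \<open>F\<close>; linearity of the old
  rows keeps the recombined directions in their kernels.\<close>

lemma load_rows:
  assumes s: "agrees s" and Dn: "\<And>i. reals s ''D'' i n = 0"
    and inv: "elimination_inv F b (alive_set n s) (reals s ''D'')"
    and F: "\<And>f. f \<in> F \<Longrightarrow> linear_row f"
    and s': "s' = run load_rows s"
  shows "\<And>i. reals s' ''D'' i n = 0"
    and "elimination_inv (F \<union> level_load ` {..<n})
      (\<lambda>S. b S + card (S \<inter> {..<n})) (alive_set n s') (reals s' ''D'')"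
proof -
  define Inv where "Inv = (\<lambda>m (t :: store). (\<forall>i. reals t ''D'' i n = 0) \<and>
    elimination_inv (F \<union> level_load ` {..<m})
      (\<lambda>S. b S + card (S \<inter> {..<m})) (alive_set n t) (reals t ''D''))"
  have "Inv n (run load_rows s)"
    unfolding load_rows_def
  proof (rule run_loop, goal_cases)
    case (3 m t)
    have t: "nats t ''n'' = nats s ''n''" "nats t ''lev'' = nats s ''lev''"
      "nats t ''ep'' = nats s ''ep''"
      by (simp_all add: 3)
    define u where "u = put_nat ''k'' 0 0 m t"
    define w where "w = run load_vals u"
    have u: "agrees u" "nats u ''k'' 0 0 = m"
      using agrees_cong[of u s] s t by (auto simp: u_def)
    have w: "nats w ''n'' 0 0 = n" "reals w ''D'' = reals t ''D''" "alive_set n w = alive_set n t"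
      using t agreesD[OF s] by (auto simp: w_def u_def nats_frame reals_frame alive_set_def)
    have val: "reals w ''val'' i 0 = level_load m (reals w ''D'' i)" if "i < n" for i
      using load_vals[OF u that] w by (simp add: w_def) (simp add: u_def)
    have "\<forall>i. reals w ''D'' i n = 0" using 3(2) w by (simp add: Inv_def)
    note el = eliminate[OF w(1) _ val refl, OF this[rule_format]]
    have "elimination_inv (insert (level_load m) (F \<union> level_load ` {..<m}))
      (\<lambda>S. b S + card (S \<inter> {..<Suc m}))
      (alive_set n (run eliminate w)) (reals (run eliminate w) ''D'')"
    proof (rule elimination_inv_step[OF _ el(1) _ local_level_load])
      show "elimination_inv (F \<union> level_load ` {..<m})
          (\<lambda>S. b S + card (S \<inter> {..<m})) (alive_set n w) (reals w ''D'')"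
        using 3(2) w by (simp add: Inv_def)
      show "linear_row g" if "g \<in> insert (level_load m) (F \<union> level_load ` {..<m})" for g
        using that F linear_level_load by auto
      show "b S + card (S \<inter> {..<m}) + of_bool (m \<in> S \<and> (\<exists>d. level_load m d \<noteq> 0))
        \<le> b S + card (S \<inter> {..<Suc m})" for S
        by (auto simp: lessThan_Suc Int_insert_right)
    qed
    then show ?case
      using el(2) by (simp add: Inv_def lessThan_Suc w_def u_def)
  qed (use agreesD[OF s] Dn inv in \<open>auto simp: Inv_def\<close>)
  then show "\<And>i. reals s' ''D'' i n = 0"
    and "elimination_inv (F \<union> level_load ` {..<n})
      (\<lambda>S. b S + card (S \<inter> {..<n})) (alive_set n s') (reals s' ''D'')"
    by (auto simp: Inv_def s')
qed

text \<open>Any surviving direction may be used, whichever group it belongs to: it lies in the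
  kernel of all rows and equals 1 at its own index. If none survives, the count of dead indices
  already yields balance.\<close>

lemma move:
  assumes s: "agrees s" and lev: "\<And>v. v < n \<Longrightarrow> lev v < n"
    and p: "potential (pot s)" and Dn: "\<And>i. reals s ''D'' i n = 0"
    and inv: "elimination_inv (tightness (pot s) ` {..<n} \<union> level_load ` {..<n})
      (\<lambda>S. card {k. k < n \<and> k \<notin> free (pot s) \<and> lev k \<in> S} + card (S \<inter> {..<n}))
      (alive_set n s) (reals s ''D'')"
    and s': "s' = run move s"
  shows "improves (pot s) (pot s') \<and> (free (pot s') \<subset> free (pot s) \<or> balanced (pot s'))"
proof -
  define t where "t = run find_alive s"
  define q where "q = nats t ''pivot'' 0 0"
  note n = agreesD(1)[OF s]
  have t: "nats t ''n'' = nats s ''n''" "nats t ''lev'' = nats s ''lev''"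
      "nats t ''ep'' = nats s ''ep''" "reals t = reals s"
    by (auto simp: t_def nats_frame reals_frame)
  then have "agrees t" using agrees_cong s by blast
  have pt: "pot t = pot s" using t by (simp add: pot_def[abs_def])
  from find_alive[OF n, folded t_def] consider "q \<in> alive_set n s" | "q = n" "alive_set n s = {}"
    by (auto simp: Let_def q_def)
  then show ?thesis
  proof cases
    case 1
    define d where "d = reals s ''D'' q"
    define u where "u = run step_size t"
    have q: "q < n" using 1 by (simp add: alive_set_def)
    have s'_eq: "s' = run shift u"
      using q n t by (simp add: s' move_def t_def[symmetric] u_def q_def[symmetric])
    have kernel: "f d = 0" if "f \<in> tightness (pot s) ` {..<n} \<union> level_load ` {..<n}" for f
      using inv 1 that unfolding elimination_inv_def d_def by blast
    have dq: "d q = 1" using inv 1 by (simp add: elimination_inv_def d_def)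
    have ms: "maximal_step (pot s) d (reals u ''t'' 0 0)"
      using step_size[OF \<open>agrees t\<close>, of q d] q dq t by (simp add: pt u_def d_def q_def)
    have u: "nats u ''n'' 0 0 = n" "nats u ''pivot'' 0 0 = q" "reals u ''D'' = reals s ''D''" "pot u = pot s"
      using n t by (auto simp: u_def nats_frame reals_frame q_def pot_def[abs_def])
    have d0: "d n = 0" using Dn by (simp add: d_def)
    then have "pot s' v = pot s v + reals u ''t'' 0 0 * d v" if "v \<le> n" for v
      using shift[OF u(1), of v] u that by (auto simp: s'_eq d_def)
    note imp = improves_step[OF p d0 _ _ lev ms this]
    show ?thesis using imp kernel by blast
  next
    case 2
    then have "s' = t" using n t by (simp add: s' move_def t_def[symmetric] q_def[symmetric])
    moreover have "balanced (pot s)"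
      by (rule balanced_if_all_killed[OF p inv[unfolded 2] refl])
    ultimately show ?thesis using p pt improves_refl by simp
  qed
qed

lemma round_step:
  assumes s: "agrees s" and lev: "\<And>v. v < n \<Longrightarrow> lev v < n"
    and p: "potential (pot s)" and Dn: "\<And>i. reals s ''D'' i n = 0"
    and s': "s' = run round_step s"
  shows "improves (pot s) (pot s') \<and> (free (pot s') \<subset> free (pot s) \<or> balanced (pot s'))"
    and "\<And>i. reals s' ''D'' i n = 0"
proof -
  define t where "t = run init_dirs s"
  define u where "u = run tightness_rows t"
  define w where "w = run load_rows u"
  have s'_eq: "s' = run move w" by (simp add: s' round_step_def t_def u_def w_def)
  have ag: "agrees t" "agrees u" "agrees w"
    using agrees_cong[of t s] agrees_cong[of u s] agrees_cong[of w s] s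
    by (simp_all add: t_def u_def w_def nats_frame)
  have pots: "pot t = pot s" "pot u = pot s" "pot w = pot s"
    by (simp_all add: pot_def[abs_def] t_def u_def w_def reals_frame)
  note init = init_dirs[OF agreesD(1)[OF s] t_def]
  have tn: "reals t ''D'' i n = 0" for i using init(3) Dn by simp
  have "elimination_inv {} (\<lambda>_. 0) (alive_set n t) (reals t ''D'')"
    unfolding init(1) by (rule elimination_inv_init) (use init(2) tn in \<open>auto simp: le_less\<close>)
  note tight = tightness_rows[OF ag(1) tn this u_def, unfolded pots]
  note load = load_rows[OF ag(2) tight _ w_def]
  have lin: "linear_row f" if "f \<in> tightness (pot s) ` {..<n}" for f
    using that linear_tightness by auto
  show "improves (pot s) (pot s') \<and> (free (pot s') \<subset> free (pot s) \<or> balanced (pot s'))"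
    using move[OF ag(3) lev _ _ _ s'_eq, unfolded pots] p load[OF lin] by blast
  show "reals s' ''D'' i n = 0" for i
    using load(1)[OF lin] by (simp add: s'_eq reals_frame)
qed

text \<open>There are at most \<open>n\<close> free vertices and every round loses one or ends
  balanced, which later rounds preserve. After \<open>n\<close> rounds the first alternative leaves
  no free vertex, and that is balanced too.\<close>

lemma round_potential:
  assumes s: "agrees s" and lev: "\<And>v. v < n \<Longrightarrow> lev v < n"
    and p: "potential (pot s)" and Dn: "\<And>i. reals s ''D'' i n = 0"
    and s': "s' = run round_potential s"
  shows "improves (pot s) (pot s')" and "balanced (pot s')"
proof -
  define Inv where "Inv = (\<lambda>m (t :: store). (\<forall>i. reals t ''D'' i n = 0) \<and>
    improves (pot s) (pot t) \<and> (card (free (pot t)) + m \<le> n \<or> balanced (pot t)))"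
  have "free (pot s) \<subseteq> {..<n}" by (auto simp: free_def)
  then have card0: "card (free (pot s)) \<le> n"
    using card_mono[of "{..<n}" "free (pot s)"] by simp
  have "Inv n (run round_potential s)"
    unfolding round_potential_def
  proof (rule run_loop, goal_cases)
    case (3 m t)
    define u where "u = put_nat ''m'' 0 0 m t"
    have "agrees t" using agrees_cong[of t s] s by (simp add: 3)
    then have u: "agrees u" "pot u = pot t" "reals u = reals t"
      using agrees_cong[of u t] by (simp_all add: u_def pot_def[abs_def])
    have t: "improves (pot s) (pot t)" "potential (pot t)" "\<And>i. reals t ''D'' i n = 0"
      using 3(2) by (auto simp: Inv_def improves_def)
    note step = round_step[OF u(1) lev _ _ refl, unfolded u, OF _ t(2,3)]
    let ?v = "run round_step u"
    have "card (free (pot ?v)) + Suc m \<le> n \<or> balanced (pot ?v)"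
    proof (cases "balanced (pot t)")
      case True
      then show ?thesis using step(1) balanced_mono by (auto simp: improves_def)
    next
      case False
      then have "card (free (pot t)) + m \<le> n" using 3(2) by (simp add: Inv_def)
      moreover have "card (free (pot ?v)) < card (free (pot t)) \<or> balanced (pot ?v)"
        using step(1) psubset_card_mono[OF finite_free] by blast
      ultimately show ?thesis by auto
    qed
    then show ?case
      using step improves_trans[OF t(1)] by (auto simp: Inv_def u_def[symmetric])
  qed (use agreesD[OF s] Dn p improves_refl card0 in \<open>auto simp: Inv_def\<close>)
  then show "improves (pot s) (pot s')" and "balanced (pot s')"
    by (auto simp: Inv_def s' balanced_def card_eq_0_iff)
qed

end

section \<open>Levels, groups and the initial potential\<close>

text \<open>\<open>n\<close> serves as infinity, since every distance is below the number of
  vertices.\<close>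

definition init_levels :: com where
  "init_levels = loop ''i'' (If (NLe (NConst 1) (nget ''root'' vi))
     (nset ''lev'' vi (NConst 0)) (nset ''lev'' vi (nvar ''n'')))"

definition relax_from :: com where
  "relax_from = loop ''j'' (If (Conj (NLe (NConst 1) (NGet ''adj'' vi vj))
       (NLess (nget ''lev'' vi) (nget ''lev'' vj)))
     (nset ''lev'' vj (NAdd (nget ''lev'' vi) (NConst 1))) Skip)"

definition relax_all :: com where
  "relax_all = loop ''i'' relax_from"

definition relax_levels :: com where
  "relax_levels = loop ''k'' relax_all"

definition max_level :: com where
  "max_level = loop ''i'' (If (NLe (nvar ''H'') (nget ''lev'' vi))
     (nset ''H'' (NConst 0) (nget ''lev'' vi)) Skip)"

text \<open>The power \<open>2 ^ e\<close> is carried along in \<open>pw\<close> and doubled by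
  addition, as naturals cannot be multiplied.\<close>

definition binary_log :: com where
  "binary_log = Seq (nset ''e'' (NConst 0) (NConst 0)) (Seq (nset ''pw'' (NConst 0) (NConst 1))
     (loop ''j'' (If (NLe (NAdd (nvar ''pw'') (nvar ''pw'')) (nvar ''H''))
       (Seq (nset ''pw'' (NConst 0) (NAdd (nvar ''pw'') (nvar ''pw'')))
            (nset ''e'' (NConst 0) (NAdd (nvar ''e'') (NConst 1)))) Skip)))"

text \<open>A group consists of the levels strictly beyond its lower height \<open>e\<close>, hence
  the mark at \<open>e + 1\<close>.\<close>

definition mark_starts :: com where
  "mark_starts = loop ''k'' (Seq binary_log (Seq (nset ''H'' (NConst 0) (nvar ''e''))
     (nset ''start'' (NAdd (nvar ''e'') (NConst 1)) (NConst 1))))"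

definition clear_parents :: com where
  "clear_parents = loop ''i'' (nset ''ep'' vi (nvar ''n''))"

definition link_children :: com where
  "link_children = loop ''j'' (If (Conj (NLe (NConst 1) (NGet ''adj'' vi vj))
       (Conj (NLess (nget ''lev'' vi) (nget ''lev'' vj))
             (NLe (nget ''start'' (nget ''lev'' vj)) (NConst 0))))
     (nset ''ep'' vj vi) Skip)"

definition link_all :: com where
  "link_all = loop ''i'' link_children"

definition scaled_x :: rexp where
  "scaled_x = RDiv (RMul (rget ''x'' vi) (ROfNat (nvar ''q''))) (rvar ''mu'')"

definition level_potential :: com where
  "level_potential = loop ''i'' (If (NEq (nget ''lev'' vi) vk)
     (If (RLe (RAdd (rget ''p'' (nget ''ep'' vi)) scaled_x) (rconst 1))
        (rset ''p'' vi (RAdd (rget ''p'' (nget ''ep'' vi)) scaled_x))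
        (rset ''p'' vi (rconst 1))) Skip)"

definition init_potential :: com where
  "init_potential = loop ''k'' level_potential"

definition select_tops :: com where
  "select_tops = loop ''i'' (If (Conj (RLess (rconst 0) (rget ''p'' vi))
       (RLe (rget ''p'' (nget ''ep'' vi)) (rconst 0)))
     (nset ''R'' vi (NConst 1)) Skip)"

lemma writes_prepare [simp]:
  "nwrites init_levels = {''i'', ''lev''}" "rwrites init_levels = {}"
  "nwrites relax_from = {''j'', ''lev''}" "rwrites relax_from = {}"
  "nwrites relax_all = {''i'', ''j'', ''lev''}" "rwrites relax_all = {}"
  "nwrites relax_levels = {''i'', ''j'', ''k'', ''lev''}" "rwrites relax_levels = {}"
  "nwrites max_level = {''i'', ''H''}" "rwrites max_level = {}"
  "nwrites binary_log = {''j'', ''e'', ''pw''}" "rwrites binary_log = {}"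
  "nwrites mark_starts = {''j'', ''k'', ''e'', ''pw'', ''H'', ''start''}" "rwrites mark_starts = {}"
  "nwrites clear_parents = {''i'', ''ep''}" "rwrites clear_parents = {}"
  "nwrites link_children = {''j'', ''ep''}" "rwrites link_children = {}"
  "nwrites link_all = {''i'', ''j'', ''ep''}" "rwrites link_all = {}"
  "nwrites level_potential = {''i''}" "rwrites level_potential = {''p''}"
  "nwrites init_potential = {''i'', ''k''}" "rwrites init_potential = {''p''}"
  "nwrites select_tops = {''i'', ''R''}" "rwrites select_tops = {}"
  by (auto simp: init_levels_def relax_from_def relax_all_def relax_levels_def max_level_def
      binary_log_def mark_starts_def clear_parents_def link_children_def link_all_def
      level_potential_def init_potential_def select_tops_def)

section \<open>Distances by repeated relaxation\<close>

lemma init_levels: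
  assumes n: "nats s ''n'' 0 0 = n" and i: "i < n"
  shows "nats (run init_levels s) ''lev'' i 0 = (if nats s ''root'' i 0 = 0 then n else 0)"
proof -
  define Inv where "Inv = (\<lambda>m (t :: store).
    \<forall>i<m. nats t ''lev'' i 0 = (if nats s ''root'' i 0 = 0 then n else 0))"
  have "Inv n (run init_levels s)"
    unfolding init_levels_def
  proof (rule run_loop, goal_cases)
    case (3 m t)
    have "nats t ''root'' = nats s ''root''" "nats t ''n'' = nats s ''n''" by (simp_all add: 3)
    then show ?case using 3(1,2) n by (auto simp: Inv_def less_Suc_eq)
  qed (use n in \<open>auto simp: Inv_def\<close>)
  with i show ?thesis by (simp add: Inv_def)
qed

text \<open>\<open>d\<close> stands for the true distances. Relaxing an arc cannot push a label
  below \<open>d\<close>, because \<open>d\<close> satisfies the arc inequality.\<close>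

lemma relax_from:
  fixes d :: "nat \<Rightarrow> nat"
  assumes n: "nats s ''n'' 0 0 = n" and i: "nats s ''i'' 0 0 = i" "i < n"
    and arc: "\<And>j. j < n \<Longrightarrow> nats s ''adj'' i j \<noteq> 0 \<Longrightarrow> d j \<le> Suc (d i)"
    and lev: "\<And>j. j < n \<Longrightarrow> d j \<le> nats s ''lev'' j 0"
    and j: "j < n"
  shows "d j \<le> nats (run relax_from s) ''lev'' j 0"
    and "nats (run relax_from s) ''lev'' j 0 \<le> nats s ''lev'' j 0"
    and "nats s ''adj'' i j \<noteq> 0 \<Longrightarrow> nats (run relax_from s) ''lev'' j 0 \<le> Suc (nats s ''lev'' i 0)"
proof -
  define Inv where "Inv = (\<lambda>m (t :: store).
    (\<forall>j<n. d j \<le> nats t ''lev'' j 0 \<and> nats t ''lev'' j 0 \<le> nats s ''lev'' j 0) \<and>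
    (\<forall>j<m. nats s ''adj'' i j \<noteq> 0 \<longrightarrow> nats t ''lev'' j 0 \<le> Suc (nats s ''lev'' i 0)))"
  have "Inv n (run relax_from s)"
    unfolding relax_from_def
  proof (rule run_loop, goal_cases)
    case (3 m t)
    have t: "nats t ''adj'' = nats s ''adj''" "nats t ''i'' = nats s ''i''" by (simp_all add: 3)
    have "d i \<le> nats t ''lev'' i 0" "nats t ''lev'' i 0 \<le> nats s ''lev'' i 0"
      using 3(2) i by (auto simp: Inv_def)
    then show ?case using 3(1,2) t i arc[OF 3(1)] by (auto simp: Inv_def less_Suc_eq)
  qed (use n lev in \<open>auto simp: Inv_def\<close>)
  then show "d j \<le> nats (run relax_from s) ''lev'' j 0"
    and "nats (run relax_from s) ''lev'' j 0 \<le> nats s ''lev'' j 0"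
    and "nats s ''adj'' i j \<noteq> 0 \<Longrightarrow> nats (run relax_from s) ''lev'' j 0 \<le> Suc (nats s ''lev'' i 0)"
    using j by (auto simp: Inv_def)
qed

lemma relax_all:
  fixes d :: "nat \<Rightarrow> nat"
  assumes n: "nats s ''n'' 0 0 = n"
    and arc: "\<And>i j. i < n \<Longrightarrow> j < n \<Longrightarrow> nats s ''adj'' i j \<noteq> 0 \<Longrightarrow> d j \<le> Suc (d i)"
    and lev: "\<And>j. j < n \<Longrightarrow> d j \<le> nats s ''lev'' j 0"
    and j: "j < n"
  shows "d j \<le> nats (run relax_all s) ''lev'' j 0"
    and "nats (run relax_all s) ''lev'' j 0 \<le> nats s ''lev'' j 0"
    and "i < n \<Longrightarrow> nats s ''adj'' i j \<noteq> 0 \<Longrightarrow>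
      nats (run relax_all s) ''lev'' j 0 \<le> Suc (nats s ''lev'' i 0)"
proof -
  define Inv where "Inv = (\<lambda>m (t :: store).
    (\<forall>j<n. d j \<le> nats t ''lev'' j 0 \<and> nats t ''lev'' j 0 \<le> nats s ''lev'' j 0) \<and>
    (\<forall>i<m. \<forall>j<n. nats s ''adj'' i j \<noteq> 0 \<longrightarrow> nats t ''lev'' j 0 \<le> Suc (nats s ''lev'' i 0)))"
  have "Inv n (run relax_all s)"
    unfolding relax_all_def
  proof (rule run_loop, goal_cases)
    case (3 m t)
    have t: "nats t ''adj'' = nats s ''adj''" "nats t ''n'' = nats s ''n''" by (simp_all add: 3)
    have inv: "d j \<le> nats t ''lev'' j 0" "nats t ''lev'' j 0 \<le> nats s ''lev'' j 0"
      "i < m \<Longrightarrow> nats s ''adj'' i j \<noteq> 0 \<Longrightarrow> nats t ''lev'' j 0 \<le> Suc (nats s ''lev'' i 0)" if "j < n" for i j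
      using 3(2) that by (auto simp: Inv_def)
    let ?u = "put_nat ''i'' 0 0 m t"
    have rf: "d j \<le> nats (run relax_from ?u) ''lev'' j 0"
        "nats (run relax_from ?u) ''lev'' j 0 \<le> nats t ''lev'' j 0"
        "nats s ''adj'' m j \<noteq> 0 \<Longrightarrow> nats (run relax_from ?u) ''lev'' j 0 \<le> Suc (nats t ''lev'' m 0)"
      if "j < n" for j
      using relax_from[of ?u n m d j] that 3(1) n t arc inv(1) by auto
    show ?case
      unfolding Inv_def
    proof (intro conjI allI impI)
      fix j assume j: "j < n"
      show "d j \<le> nats (run relax_from ?u) ''lev'' j 0" by (rule rf(1)[OF j])
      show "nats (run relax_from ?u) ''lev'' j 0 \<le> nats s ''lev'' j 0"
        using rf(2)[OF j] inv(2)[OF j] by linarith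
    next
      fix i j assume "i < Suc m" "j < n" "nats s ''adj'' i j \<noteq> 0"
      then consider "i = m" "nats s ''adj'' m j \<noteq> 0" "j < n" | "i < m" "nats s ''adj'' i j \<noteq> 0" "j < n"
        by (auto simp: less_Suc_eq)
      then show "nats (run relax_from ?u) ''lev'' j 0 \<le> Suc (nats s ''lev'' i 0)"
      proof cases
        case 1
        then show ?thesis using rf(3)[of j] inv(2)[OF 3(1)] by simp
      next
        case 2
        then show ?thesis using rf(2)[of j] inv(3)[of j i] by simp
      qed
    qed
  qed (use n lev in \<open>auto simp: Inv_def\<close>)
  then show "d j \<le> nats (run relax_all s) ''lev'' j 0"
    and "nats (run relax_all s) ''lev'' j 0 \<le> nats s ''lev'' j 0"
    and "i < n \<Longrightarrow> nats s ''adj'' i j \<noteq> 0 \<Longrightarrow>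
      nats (run relax_all s) ''lev'' j 0 \<le> Suc (nats s ''lev'' i 0)"
    using j by (auto simp: Inv_def)
qed

text \<open>The Bellman-Ford argument: round \<open>m + 1\<close> settles the vertices at distance
  \<open>m + 1\<close> through a predecessor settled before. Labels changed within a round are read
  at once, so labels beyond distance \<open>m\<close> are only bounded from below.\<close>

lemma relax_levels:
  fixes d :: "nat \<Rightarrow> nat"
  assumes n: "nats s ''n'' 0 0 = n"
    and arc: "\<And>i j. i < n \<Longrightarrow> j < n \<Longrightarrow> nats s ''adj'' i j \<noteq> 0 \<Longrightarrow> d j \<le> Suc (d i)"
    and pred: "\<And>j. j < n \<Longrightarrow> d j \<noteq> 0 \<Longrightarrow> \<exists>i<n. nats s ''adj'' i j \<noteq> 0 \<and> d j = Suc (d i)"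
    and lev: "\<And>j. j < n \<Longrightarrow> d j \<le> nats s ''lev'' j 0"
    and lev0: "\<And>j. j < n \<Longrightarrow> d j = 0 \<Longrightarrow> nats s ''lev'' j 0 = 0"
    and dn: "\<And>j. j < n \<Longrightarrow> d j \<le> n"
    and j: "j < n"
  shows "nats (run relax_levels s) ''lev'' j 0 = d j"
proof -
  define Inv where "Inv = (\<lambda>m (t :: store).
    (\<forall>j<n. d j \<le> nats t ''lev'' j 0 \<and> (d j \<le> m \<longrightarrow> nats t ''lev'' j 0 \<le> d j)))"
  have "Inv n (run relax_levels s)"
    unfolding relax_levels_def
  proof (rule run_loop, goal_cases)
    case (3 m t)
    have t: "nats t ''adj'' = nats s ''adj''" "nats t ''n'' = nats s ''n''" by (simp_all add: 3)
    have inv: "d j \<le> nats t ''lev'' j 0" "d j \<le> m \<Longrightarrow> nats t ''lev'' j 0 \<le> d j" if "j < n" for j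
      using 3(2) that by (auto simp: Inv_def)
    let ?u = "put_nat ''k'' 0 0 m t"
    have ra: "d j \<le> nats (run relax_all ?u) ''lev'' j 0"
        "nats (run relax_all ?u) ''lev'' j 0 \<le> nats t ''lev'' j 0"
        "i < n \<Longrightarrow> nats s ''adj'' i j \<noteq> 0 \<Longrightarrow>
          nats (run relax_all ?u) ''lev'' j 0 \<le> Suc (nats t ''lev'' i 0)"
      if "j < n" for i j
      using relax_all(1,2)[of ?u n d j] relax_all(3)[of ?u n d j i] that n t arc inv(1) by auto
    show ?case
      unfolding Inv_def
    proof (intro conjI allI impI)
      fix j assume j: "j < n"
      show "d j \<le> nats (run relax_all ?u) ''lev'' j 0" by (rule ra(1)[OF j])
      assume le: "d j \<le> Suc m"
      show "nats (run relax_all ?u) ''lev'' j 0 \<le> d j"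
      proof (cases "d j \<le> m")
        case True
        then show ?thesis using ra(2)[OF j] inv(2)[OF j] by linarith
      next
        case False
        then obtain i where i: "i < n" "nats s ''adj'' i j \<noteq> 0" "d j = Suc (d i)"
          using pred[OF j] by auto
        then have "nats t ''lev'' i 0 \<le> d i" using inv(2)[of i] le by simp
        then show ?thesis using ra(3)[OF j i(1,2)] i(3) by linarith
      qed
    qed
  qed (use n lev lev0 in \<open>auto simp: Inv_def\<close>)
  with j dn[OF j] show ?thesis by (fastforce simp: Inv_def)
qed

lemma max_level:
  assumes n: "nats s ''n'' 0 0 = n" and H: "nats s ''H'' 0 0 = 0"
    and s': "s' = run max_level s"
  shows "\<And>i. i < n \<Longrightarrow> nats s ''lev'' i 0 \<le> nats s' ''H'' 0 0"
    and "nats s' ''H'' 0 0 = 0 \<or> (\<exists>i<n. nats s' ''H'' 0 0 = nats s ''lev'' i 0)"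
proof -
  define Inv where "Inv = (\<lambda>m (t :: store).
    (\<forall>i<m. nats s ''lev'' i 0 \<le> nats t ''H'' 0 0) \<and>
    (nats t ''H'' 0 0 = 0 \<or> (\<exists>i<m. nats t ''H'' 0 0 = nats s ''lev'' i 0)))"
  have "Inv n (run max_level s)"
    unfolding max_level_def
  proof (rule run_loop, goal_cases)
    case (3 m t)
    have t: "nats t ''lev'' = nats s ''lev''" by (simp add: 3)
    then show ?case using 3(1,2) by (fastforce simp: Inv_def less_Suc_eq)
  qed (use n H in \<open>auto simp: Inv_def\<close>)
  then show "\<And>i. i < n \<Longrightarrow> nats s ''lev'' i 0 \<le> nats s' ''H'' 0 0"
    and "nats s' ''H'' 0 0 = 0 \<or> (\<exists>i<n. nats s' ''H'' 0 0 = nats s ''lev'' i 0)"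
    by (auto simp: Inv_def s')
qed

section \<open>Integer logarithms and group boundaries\<close>

lemma floor_log_eqI:
  assumes "2 ^ e \<le> m" "m < 2 * 2 ^ e"
  shows "floor_log m = e"
proof (rule antisym)
  have "m > 0" using assms(1) by (metis gr0I le_zero_eq power_not_zero zero_neq_numeral)
  then have "2 ^ floor_log m < (2 :: nat) ^ Suc e"
    using floor_log_exp2_le[of m] assms(2) by simp
  then show "floor_log m \<le> e"
    using power_less_imp_less_exp[of "2 :: nat" "floor_log m" "Suc e"] by simp
  have "(2 :: nat) ^ e < 2 ^ Suc (floor_log m)"
    using floor_log_exp2_gt[of m] assms(1) by simp
  then show "e \<le> floor_log m"
    using power_less_imp_less_exp[of "2 :: nat" e "Suc (floor_log m)"] by simp
qed

text \<open>\<open>n\<close> attempts at doubling suffice because \<open>n < 2 * 2 ^ n\<close>. For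
  argument 0 the exponent stays 0, in agreement with \<open>floor_log 0 = 0\<close>.\<close>

lemma binary_log:
  assumes n: "nats s ''n'' 0 0 = n" and H: "nats s ''H'' 0 0 \<le> n"
  shows "nats (run binary_log s) ''e'' 0 0 = floor_log (nats s ''H'' 0 0)"
proof -
  let ?H = "nats s ''H'' 0 0"
  define Inv where "Inv = (\<lambda>m (t :: store). let e = nats t ''e'' 0 0 in
    nats t ''pw'' 0 0 = 2 ^ e \<and> (e = 0 \<or> 2 ^ e \<le> ?H) \<and> (e = m \<or> ?H < 2 * 2 ^ e))"
  have "Inv n (run binary_log s)"
    unfolding binary_log_def run.simps(4)
  proof (rule run_loop, goal_cases)
    case (3 m t)
    have t: "nats t ''H'' = nats s ''H''" by (simp add: 3)
    then show ?case using 3(1,2) by (auto simp: Inv_def Let_def)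
  qed (use n in \<open>auto simp: Inv_def\<close>)
  moreover define e where "e = nats (run binary_log s) ''e'' 0 0"
  moreover have "n < 2 * 2 ^ n" using less_exp[of n] by (rule less_trans) simp
  ultimately have e: "e = 0 \<or> 2 ^ e \<le> ?H" "?H < 2 * 2 ^ e"
    using H by (auto simp: Inv_def Let_def)
  show ?thesis
  proof (cases "2 ^ e \<le> ?H")
    case True
    then show ?thesis using floor_log_eqI[OF True e(2)] by (simp add: e_def)
  next
    case False
    then have "e = 0" "?H = 0" using e by auto
    then show ?thesis by (simp add: e_def)
  qed
qed

lemma floor_log_le: "floor_log m \<le> m"
proof (cases "m > 0")
  case True
  then show ?thesis
    using floor_log_exp2_le[of m] less_exp[of "floor_log m"] by linarith
qed simp

lemma mark_starts:
  assumes n: "nats s ''n'' 0 0 = n" and H: "nats s ''H'' 0 0 = L" "L \<le> n"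
    and start: "\<And>l. nats s ''start'' l 0 = 0"
  shows "nats (run mark_starts s) ''start'' l 0 \<noteq> 0 \<longleftrightarrow>
    (\<exists>i\<in>{1..n}. l = Suc ((floor_log ^^ i) L))"
proof -
  have le: "(floor_log ^^ i) L \<le> L" for i
    by (induction i) (auto intro: order_trans[OF floor_log_le])
  define Inv where "Inv = (\<lambda>m (t :: store). nats t ''H'' 0 0 = (floor_log ^^ m) L \<and>
    (\<forall>l. nats t ''start'' l 0 \<noteq> 0 \<longleftrightarrow> (\<exists>i\<in>{1..m}. l = Suc ((floor_log ^^ i) L))))"
  have "Inv n (run mark_starts s)"
    unfolding mark_starts_def
  proof (rule run_loop, goal_cases)
    case (3 m t)
    let ?u = "put_nat ''k'' 0 0 m t"
    have "nats t ''n'' = nats s ''n''" by (simp add: 3)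
    then have "nats (run binary_log ?u) ''e'' 0 0 = (floor_log ^^ Suc m) L"
      using binary_log[of ?u n] n H le[of m] 3(2) by (simp add: Inv_def)
    then show ?case using 3(2)
      by (auto simp: Inv_def nats_frame atLeastAtMostSuc_conv)
  qed (use n H start in \<open>auto simp: Inv_def\<close>)
  then show ?thesis by (simp add: Inv_def)
qed

section \<open>Links within groups and truncated path sums\<close>

lemma clear_parents:
  assumes n: "nats s ''n'' 0 0 = n" and i: "i < n"
  shows "nats (run clear_parents s) ''ep'' i 0 = n"
proof -
  define Inv where "Inv = (\<lambda>m (t :: store). \<forall>i<m. nats t ''ep'' i 0 = n)"
  have "Inv n (run clear_parents s)"
    unfolding clear_parents_def
  proof (rule run_loop, goal_cases)
    case (3 m t)
    have "nats t ''n'' = nats s ''n''" by (simp add: 3)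
    then show ?case using 3(1,2) n by (auto simp: Inv_def less_Suc_eq)
  qed (use n in \<open>auto simp: Inv_def\<close>)
  with i show ?thesis by (simp add: Inv_def)
qed

text \<open>Adjacency and a smaller level single out the parent; the last conjunct cuts the link at
  the top level of a group.\<close>

definition links :: "store \<Rightarrow> nat \<Rightarrow> nat \<Rightarrow> bool" where
  "links s i j \<longleftrightarrow> nats s ''adj'' i j \<noteq> 0 \<and> nats s ''lev'' i 0 < nats s ''lev'' j 0 \<and>
     nats s ''start'' (nats s ''lev'' j 0) 0 = 0"

lemma link_children:
  assumes n: "nats s ''n'' 0 0 = n" and i: "nats s ''i'' 0 0 = i"
  shows "nats (run link_children s) ''ep'' j 0 =
    (if j < n \<and> links s i j then i else nats s ''ep'' j 0)"
proof -
  define Inv where "Inv = (\<lambda>m (t :: store). \<forall>j. nats t ''ep'' j 0 =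
    (if j < m \<and> links s i j then i else nats s ''ep'' j 0))"
  have "Inv n (run link_children s)"
    unfolding link_children_def
  proof (rule run_loop, goal_cases)
    case (3 m t)
    have "nats t ''i'' = nats s ''i''" "nats t ''adj'' = nats s ''adj''"
      "nats t ''lev'' = nats s ''lev''" "nats t ''start'' = nats s ''start''"
      by (simp_all add: 3)
    then show ?case using 3(1,2) i by (auto simp: Inv_def less_Suc_eq links_def)
  qed (use n in \<open>auto simp: Inv_def\<close>)
  then show ?thesis by (simp add: Inv_def)
qed

text \<open>By \<open>uniq\<close> at most one \<open>i\<close> writes to a given \<open>j\<close>,
  so the order of the loop is immaterial.\<close>

lemma link_all:
  assumes n: "nats s ''n'' 0 0 = n" and j: "j < n"
    and uniq: "\<And>i j. i < n \<Longrightarrow> j < n \<Longrightarrow> links s i j \<Longrightarrow> i = pa j"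
  shows "nats (run link_all s) ''ep'' j 0 =
    (if \<exists>i<n. links s i j then pa j else nats s ''ep'' j 0)"
proof -
  define Inv where "Inv = (\<lambda>m (t :: store). \<forall>j<n. nats t ''ep'' j 0 =
    (if \<exists>i<m. links s i j then pa j else nats s ''ep'' j 0))"
  have "Inv n (run link_all s)"
    unfolding link_all_def
  proof (rule run_loop, goal_cases)
    case (3 m t)
    let ?u = "put_nat ''i'' 0 0 m t"
    have t: "nats t ''n'' = nats s ''n''" "nats t ''adj'' = nats s ''adj''"
      "nats t ''lev'' = nats s ''lev''" "nats t ''start'' = nats s ''start''"
      by (simp_all add: 3)
    then have l: "links ?u = links s" by (simp add: links_def[abs_def])
    have "nats (run link_children ?u) ''ep'' j 0 =
        (if j < n \<and> links s m j then m else nats t ''ep'' j 0)" for j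
      using link_children[of ?u n m j] n t l by simp
    then show ?case
      using 3(1,2) uniq[OF 3(1)] by (auto simp: Inv_def less_Suc_eq)
  qed (use n in \<open>auto simp: Inv_def\<close>)
  with j show ?thesis by (simp add: Inv_def)
qed

lemma select_tops:
  assumes n: "nats s ''n'' 0 0 = n" and R: "\<And>i. nats s ''R'' i 0 = 0" and i: "i < n"
  shows "nats (run select_tops s) ''R'' i 0 \<noteq> 0 \<longleftrightarrow> 0 < pot s i \<and> pot s (nats s ''ep'' i 0) \<le> 0"
proof -
  define Inv where "Inv = (\<lambda>m (t :: store). \<forall>i. nats t ''R'' i 0 =
     (if i < m \<and> 0 < pot s i \<and> pot s (nats s ''ep'' i 0) \<le> 0 then 1 else 0))"
  have "Inv n (run select_tops s)"
    unfolding select_tops_def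
  proof (rule run_loop, goal_cases)
    case (3 m t)
    have t: "nats t ''ep'' = nats s ''ep''" "reals t ''p'' = reals s ''p''" by (simp_all add: 3)
    have "nats t ''R'' i 0 = (if i < m \<and> 0 < pot s i \<and> pot s (nats s ''ep'' i 0) \<le> 0 then 1 else 0)" for i
      using 3(2) by (simp add: Inv_def)
    then show ?case by (simp add: Inv_def less_Suc_eq pot_def t)
  qed (use n R in \<open>auto simp: Inv_def\<close>)
  with i show ?thesis by (simp add: Inv_def)
qed

definition scaled :: "store \<Rightarrow> nat \<Rightarrow> real" where
  "scaled s i = reals s ''x'' i 0 * real (nats s ''q'' 0 0) / reals s ''mu'' 0 0"

context layered_forest
begin

lemma level_potential:
  assumes s: "agrees s" and k: "nats s ''k'' 0 0 = k"
  shows "pot (run level_potential s) i =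
    (if i < n \<and> lev i = k then min 1 (pot s (ep i) + scaled s i) else pot s i)"
proof -
  define Inv where "Inv = (\<lambda>m (t :: store). \<forall>i. pot t i =
    (if i < m \<and> lev i = k then min 1 (pot s (ep i) + scaled s i) else pot s i))"
  have "Inv n (run level_potential s)"
    unfolding level_potential_def
  proof (rule run_loop, goal_cases)
    case (3 m t)
    have t: "nats t ''k'' = nats s ''k''" "nats t ''lev'' = nats s ''lev''" "nats t ''ep'' = nats s ''ep''"
      "nats t ''q'' = nats s ''q''" "reals t ''x'' = reals s ''x''" "reals t ''mu'' = reals s ''mu''"
      by (simp_all add: 3)
    \<comment> \<open>The entry read is the dummy or belongs to the preceding level, so this pass
      over level \<open>k\<close> does not overwrite it.\<close>
    have "pot t (ep m) = pot s (ep m)" if "lev m = k"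
      using 3(1)
    proof (cases rule: ep_cases)
      case 1
      then show ?thesis using 3(1,2) by (simp add: Inv_def)
    next
      case 2
      then show ?thesis using 3(2) that by (simp add: Inv_def)
    qed
    then show ?case
      using 3(1,2) t k agreesD[OF s]
      by (auto simp: Inv_def less_Suc_eq pot_def scaled_def scaled_x_def min_def)
  qed (use agreesD[OF s] in \<open>auto simp: Inv_def\<close>)
  then show ?thesis by (simp add: Inv_def)
qed

text \<open>Levels are processed away from the root, so the value at \<open>ep i\<close> is final
  when \<open>i\<close> is treated and the assignment persists as an equation.\<close>

lemma init_potential:
  assumes s: "agrees s" and lev: "\<And>v. v < n \<Longrightarrow> lev v < n" and pn: "pot s n = 0"
    and s': "s' = run init_potential s"
  shows "pot s' n = 0" and "\<And>i. i < n \<Longrightarrow> pot s' i = min 1 (pot s' (ep i) + scaled s i)"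
proof -
  define Inv where "Inv = (\<lambda>m (t :: store). pot t n = 0 \<and>
    (\<forall>i<n. lev i < m \<longrightarrow> pot t i = min 1 (pot t (ep i) + scaled s i)))"
  have "Inv n (run init_potential s)"
    unfolding init_potential_def
  proof (rule run_loop, goal_cases)
    case (3 m t)
    have t: "nats t ''n'' = nats s ''n''" "nats t ''lev'' = nats s ''lev''" "nats t ''ep'' = nats s ''ep''"
      "nats t ''q'' = nats s ''q''" "reals t ''x'' = reals s ''x''" "reals t ''mu'' = reals s ''mu''"
      by (simp_all add: 3)
    let ?u = "put_nat ''k'' 0 0 m t"
    let ?v = "run level_potential ?u"
    have u: "agrees ?u" "scaled ?u = scaled s" "pot ?u = pot t"
      using agrees_cong[of ?u s] s t by (auto simp: scaled_def[abs_def] pot_def[abs_def])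
    have v: "pot ?v i = (if i < n \<and> lev i = m then min 1 (pot t (ep i) + scaled s i) else pot t i)" for i
      using level_potential[OF u(1), of m i] u by simp
    have "pot ?v i = min 1 (pot ?v (ep i) + scaled s i)" if i: "i < n" "lev i < Suc m" for i
    proof -
      have "pot ?v (ep i) = pot t (ep i)"
        using i(1) by (cases rule: ep_cases) (use v i(2) in auto)
      then show ?thesis using v[of i] i 3(2) by (auto simp: Inv_def less_Suc_eq)
    qed
    then show ?case using v[of n] 3(2) by (auto simp: Inv_def)
  qed (use agreesD[OF s] pn in \<open>auto simp: Inv_def\<close>)
  then show "pot s' n = 0" and "\<And>i. i < n \<Longrightarrow> pot s' i = min 1 (pot s' (ep i) + scaled s i)"
    using lev by (auto simp: Inv_def s')
qed

end

section \<open>Correctness of the algorithm\<close>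

definition algorithm :: com where
  "algorithm = Seq init_levels (Seq relax_levels (Seq max_level (Seq mark_starts
     (Seq clear_parents (Seq link_all (Seq init_potential (Seq round_potential select_tops)))))))"

lemma n_bounded_algorithm: "n_bounded algorithm"
  by (simp add: algorithm_def init_levels_def relax_from_def relax_all_def relax_levels_def
      max_level_def binary_log_def mark_starts_def clear_parents_def link_children_def link_all_def
      level_potential_def init_potential_def select_tops_def init_dir_def init_dirs_def
      tightness_vals_def load_val_def load_vals_def tightness_rows_def load_rows_def find_alive_def
      lower_step_def step_size_def shift_def move_def round_step_def round_potential_def
      find_pivot_def reduce_row_def reduce_rows_def eliminate_def)

section \<open>Integer versus real iterated logarithms\<close>

text \<open>Rounding early is harmless because powers of two are integers:
  \<open>2 ^ e \<le> y\<close> holds exactly when it holds for the floor of \<open>y\<close>. For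
  \<open>y < 1\<close> both sides are 0.\<close>

lemma floor_log_nat_floor:
  assumes "0 < y"
  shows "floor_log (nat \<lfloor>y\<rfloor>) = nat \<lfloor>log 2 y\<rfloor>"
proof (cases "1 \<le> y")
  case True
  define m where "m = nat \<lfloor>y\<rfloor>"
  define e where "e = floor_log m"
  have m: "1 \<le> m" "real m \<le> y" "y < real m + 1"
    using True by (auto simp: m_def le_nat_iff)
  have "2 ^ e \<le> m" "m < 2 * 2 ^ e"
    using floor_log_exp2_le[of m] floor_log_exp2_gt[of m] m(1) by (auto simp: e_def)
  \<comment> \<open>Over the integers the strict upper bound gains 1, which absorbs the fractional
    part of \<open>y\<close>.\<close>
  then have "2 ^ e \<le> m" "m + 1 \<le> 2 * 2 ^ e" by auto
  from this[THEN of_nat_mono, where 'a = real]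
  have "2 ^ e \<le> real m" "real m + 1 \<le> 2 * 2 ^ e" by simp_all
  then have "2 ^ e \<le> y" "y < 2 * 2 ^ e" using m by linarith+
  then have "2 powr e \<le> y" "y < 2 powr (e + 1)"
    by (auto simp: powr_add powr_realpow)
  then have "real e \<le> log 2 y" "log 2 y < real e + 1"
    using assms by (auto simp: le_log_iff log_less_iff add.commute)
  then have "\<lfloor>log 2 y\<rfloor> = int e" by (simp add: floor_eq_iff)
  then show ?thesis by (simp add: m_def[symmetric] e_def)
next
  case False
  then have "nat \<lfloor>y\<rfloor> = 0" "log 2 y < 0" using assms by auto
  then show ?thesis by simp
qed

text \<open>The arguments of the first \<open>q\<close> logarithms are positive, but the last value
  may be negative; both sides are then 0.\<close>

lemma floor_log_iter:
  assumes "iter_log_defined q (real L)" "i \<le> q"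
  shows "(floor_log ^^ i) L = nat \<lfloor>iter_log i (real L)\<rfloor>"
  using assms(2)
proof (induction i)
  case 0
  then show ?case by (simp add: iter_log_def)
next
  case (Suc i)
  then have "0 < iter_log i (real L)" using assms(1) by (simp add: iter_log_defined_def)
  then show ?case using Suc floor_log_nat_floor by (simp add: iter_log_def)
qed

lemma floor_log_less: "0 < m \<Longrightarrow> floor_log m < m"
  using floor_log_exp2_le[of m] less_exp[of "floor_log m"] by linarith

section \<open>The forest of groups in an enumerated tree\<close>

locale enumerated_tree = rooted G r
  for G :: "'a pair_pre_digraph" and r :: 'a +
  fixes vs :: "'a list"
  assumes distinct_vs: "distinct vs" and set_vs: "set vs = pverts G"
begin

abbreviation "n \<equiv> length vs"

definition lev :: "nat \<Rightarrow> nat" where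
  "lev i = gdist G r (vs ! i)"

definition par_ix :: "nat \<Rightarrow> nat" where
  "par_ix j = (SOME i. i < n \<and> vs ! i = parent (vs ! j))"

text \<open>The levels between \<open>height (Suc i)\<close> (exclusive) and \<open>height i\<close> (inclusive) form a group.\<close>

definition height :: "nat \<Rightarrow> nat" where
  "height i = (floor_log ^^ i) (depth G r)"

definition is_start :: "nat \<Rightarrow> bool" where
  "is_start l \<longleftrightarrow> (\<exists>i\<ge>1. l = Suc (height i))"

text \<open>As the heights reach 0, level 1 always starts a group, so the root is isolated in the
  forest.\<close>

definition ep :: "nat \<Rightarrow> nat" where
  "ep j = (if lev j = 0 \<or> is_start (lev j) then n else par_ix j)"

lemma n_card: "n = card (pverts G)"
  using distinct_vs set_vs distinct_card by metis

lemma vs_in [simp]: "i < n \<Longrightarrow> vs ! i \<in> pverts G"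
  using set_vs nth_mem by blast

lemma vs_ix: "w \<in> pverts G \<Longrightarrow> \<exists>i<n. vs ! i = w"
  using set_vs by (metis in_set_conv_nth)

lemma vs_inj: "i < n \<Longrightarrow> j < n \<Longrightarrow> vs ! i = vs ! j \<Longrightarrow> i = j"
  using distinct_vs nth_eq_iff_index_eq by blast

lemma lev_0_iff: "i < n \<Longrightarrow> lev i = 0 \<longleftrightarrow> vs ! i = r"
  by (simp add: lev_def gdist_eq_0_iff)

lemma lev_less: "i < n \<Longrightarrow> lev i < n"
  by (simp add: lev_def n_card gdist_less_card)

lemma par_ix:
  assumes "j < n"
  shows "par_ix j < n" "vs ! par_ix j = parent (vs ! j)"
  using someI_ex[OF vs_ix[OF parent_in_verts[OF vs_in[OF assms]]]] by (auto simp: par_ix_def)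

lemma lev_par_ix: "j < n \<Longrightarrow> lev j \<noteq> 0 \<Longrightarrow> lev j = Suc (lev (par_ix j))"
  using gdist_parent[of "vs ! j"] lev_0_iff[of j] par_ix[of j] by (simp add: lev_def)

lemma lev_le_depth: "i < n \<Longrightarrow> lev i \<le> depth G r"
  unfolding lev_def depth_def using pair_finite_verts by (intro Max_ge) auto

lemma depth_attained: "\<exists>i<n. lev i = depth G r"
proof -
  have "depth G r \<in> gdist G r ` pverts G"
    unfolding depth_def using pair_finite_verts root_in_verts by (intro Max_in) auto
  then obtain w where "w \<in> pverts G" "gdist G r w = depth G r" by auto
  then show ?thesis using vs_ix[of w] by (auto simp: lev_def)
qed

lemma depth_less: "depth G r < n"
  using depth_attained lev_less by metis

lemma height_Suc: "height (Suc i) = floor_log (height i)"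
  by (simp add: height_def)

lemma height_0 [simp]: "height 0 = depth G r"
  by (simp add: height_def)

lemma height_antimono: "i \<le> j \<Longrightarrow> height j \<le> height i"
  by (induction j rule: dec_induct) (auto simp: height_Suc intro: order_trans[OF floor_log_le])

lemma height_le: "height i \<le> depth G r - i"
proof (induction i)
  case (Suc i)
  then show ?case
    using floor_log_less[of "height i"] by (cases "height i = 0") (auto simp: height_Suc)
qed simp

text \<open>Heights drop by at least one until they are 0, so after \<open>n\<close> iterations no
  new boundary can appear.\<close>

lemma is_start_iff: "(\<exists>i\<in>{1..n}. l = Suc (height i)) \<longleftrightarrow> is_start l"
proof
  assume "is_start l"
  then obtain i where i: "1 \<le> i" "l = Suc (height i)" by (auto simp: is_start_def)
  show "\<exists>i\<in>{1..n}. l = Suc (height i)"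
  proof (cases "i \<le> n")
    case False
    then have "height i = 0" "height n = 0"
      using height_le[of i] height_le[of n] depth_less by auto
    then show ?thesis using i depth_less by (intro bexI[of _ n]) auto
  qed (use i in auto)
qed (auto simp: is_start_def)

sublocale layered_forest n lev ep
proof
  fix v assume v: "v < n"
  show "ep v \<le> n" using par_ix[OF v] by (simp add: ep_def)
  show "lev v = Suc (lev (ep v))" if "ep v < n"
    using that lev_par_ix[OF v] by (auto simp: ep_def split: if_splits)
qed

lemma closed_group: "closed_levels {height (Suc i)<..height i}"
  unfolding closed_levels_def
proof (intro allI impI)
  fix v assume v: "v < n" "ep v < n"
  then have l: "lev v = Suc (lev (ep v))" using lev_ep by blast
  have ns: "lev v \<noteq> Suc (height j)" if "1 \<le> j" for j
    using v(2) that by (auto simp: ep_def is_start_def split: if_splits)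
  \<comment> \<open>For \<open>i = 0\<close> this level would lie beyond the depth of the tree; for
    larger \<open>i\<close> it starts a group, and \<open>v\<close> would have no link.\<close>
  have "lev v \<noteq> Suc (height i)"
    using ns[of i] lev_le_depth[OF v(1)] by (cases "i = 0") auto
  then show "lev v \<in> {height (Suc i)<..height i} \<longleftrightarrow> lev (ep v) \<in> {height (Suc i)<..height i}"
    using l ns[of "Suc i"] by auto
qed

lemma group_exists:
  assumes "0 < l" "l \<le> depth G r"
  shows "\<exists>i. l \<in> {height (Suc i)<..height i}"
proof -
  have ex: "\<exists>i. height (Suc i) < l"
    using height_le[of "Suc (depth G r)"] assms by (intro exI[of _ "depth G r"]) simp
  define i where "i = (LEAST i. height (Suc i) < l)"
  have "height (Suc i) < l" unfolding i_def using LeastI_ex[OF ex] .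
  moreover have "l \<le> height i"
  proof (cases i)
    case (Suc j)
    then have "\<not> height (Suc j) < l" using not_less_Least[of j "\<lambda>i. height (Suc i) < l"] i_def by simp
    then show ?thesis using Suc by simp
  qed (use assms in simp)
  ultimately show ?thesis by auto
qed

text \<open>The logarithmic spacing enters here: the group has at most \<open>height i\<close>
  levels, this is at most \<open>2 ^ Suc (height (Suc i))\<close>, and every level of the group is
  at least \<open>Suc (height (Suc i))\<close>.\<close>

lemma card_group_le:
  assumes "l \<in> {height (Suc i)<..height i}"
  shows "card ({height (Suc i)<..height i} \<inter> {..<n}) \<le> 2 ^ l"
proof -
  have "card ({height (Suc i)<..height i} \<inter> {..<n}) \<le> card {height (Suc i)<..height i}"
    by (intro card_mono) auto
  also have "\<dots> \<le> height i" by simp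
  also have "\<dots> \<le> 2 ^ Suc (height (Suc i))"
    using floor_log_exp2_ge[of "height i"] by (simp add: height_Suc)
  also have "\<dots> \<le> 2 ^ l"
    using assms by (intro power_increasing) auto
  finally show ?thesis .
qed

lemma level_eq: "level G r l = (!) vs ` {i. i < n \<and> lev i = l}"
  using vs_ix by (fastforce simp: level_def lev_def)

lemma sum_level: "sum f (level G r l) = (\<Sum>i | i < n \<and> lev i = l. f (vs ! i))"
  unfolding level_eq by (subst sum.reindex) (auto intro!: inj_onI vs_inj)

text \<open>
  While no truncation at 1 occurs, the scaled weight of a root path is the sum of the potentials
  at the lower ends of the groups it crosses, all but the last of which are below 1.
\<close>

lemma path_weight_le:
  assumes p: "\<And>i. i < n \<Longrightarrow> p i = min 1 (p (ep i) + c * x (vs ! i))" "p n = 0"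
    and x: "\<And>w. w \<in> pverts G - {r} \<Longrightarrow> gdist G r w \<le> height q \<Longrightarrow> x w = 0"
    and xr: "x r = 0"
    and nonneg: "\<And>i. i < n \<Longrightarrow> 0 \<le> p i"
    and i: "i < n" and a: "a < q" "lev i \<le> height a"
    and not1: "\<And>j. j < n \<Longrightarrow> vs ! j \<in> root_path G r (vs ! i) \<Longrightarrow> p j < 1"
  shows "c * sum x (root_path G r (vs ! i)) \<le> real (q - Suc a) + p i"
  using i a not1
proof (induction "lev i" arbitrary: i a rule: less_induct)
  case less
  note i = \<open>i < n\<close>
  show ?case
  proof (cases "lev i = 0")
    case True
    then show ?thesis using lev_0_iff[OF i] nonneg[OF i] by (simp add: root_path_root)
  next
    case False
    let ?u = "par_ix i"
    have nr: "vs ! i \<noteq> r" using False lev_0_iff[OF i] by simp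
    note u = par_ix[OF i]
    note rp = root_path_parent[OF vs_in[OF i] nr, folded u(2)]
    have lu: "lev i = Suc (lev ?u)" using lev_par_ix[OF i False] .
    have lt1: "p i < 1" using less.prems(4)[OF i] rp(1) by simp
    have sum: "c * sum x (root_path G r (vs ! i)) =
        c * x (vs ! i) + c * sum x (root_path G r (vs ! ?u))"
      using rp finite_root_path[OF vs_in[OF u(1)]] by (simp add: distrib_left)
    have not1: "p j < 1" if "j < n" "vs ! j \<in> root_path G r (vs ! ?u)" for j
      using less.prems(4)[OF that(1)] that(2) rp(1) by simp
    have IH: "c * sum x (root_path G r (vs ! ?u)) \<le> real (q - Suc b) + p ?u"
      if "b < q" "lev ?u \<le> height b" for b
      using less.hyps[of ?u b] that lu u(1) not1 by simp
    show ?thesis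
    proof (cases "is_start (lev i)")
      case False
      then have "ep i = ?u" using \<open>lev i \<noteq> 0\<close> by (simp add: ep_def)
      then have "p i = p ?u + c * x (vs ! i)" using p(1)[OF i] lt1 by simp
      moreover have "c * sum x (root_path G r (vs ! ?u)) \<le> real (q - Suc a) + p ?u"
        using IH[of a] less.prems lu by simp
      ultimately show ?thesis using sum by linarith
    next
      case True
      then obtain b where b: "1 \<le> b" "lev i = Suc (height b)" by (auto simp: is_start_def)
      have "ep i = n" using True by (simp add: ep_def)
      then have pi: "p i = c * x (vs ! i)" using p(1)[OF i] p(2) lt1 by simp
      have "height b < height a" using b(2) less.prems(3) by simp
      then have "Suc a \<le> b" using height_antimono[of b a] by (meson not_less not_less_eq_eq)
      then have le: "lev ?u \<le> height (Suc a)" using height_antimono[of "Suc a" b] b(2) lu by simp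
      \<comment> \<open>Crossing a group boundary lowers the number of remaining groups by at least
        one, which pays for \<open>p ?u \<le> 1\<close>.\<close>
      have "c * sum x (root_path G r (vs ! ?u)) \<le> real (q - Suc a)"
      proof (cases "Suc a < q")
        case True
        have "p ?u \<le> 1"
          using p(1)[OF u(1)] by simp
        moreover have "real (q - Suc a) = real (q - Suc (Suc a)) + 1" using True by simp
        ultimately show ?thesis using IH[OF True le] by linarith
      next
        \<comment> \<open>Group \<open>a\<close> was the last one that \<open>x\<close> meets: the
          rest of the path stays within the levels up to \<open>height q\<close> and carries no
          weight.\<close>
        case False
        then have q: "q = Suc a" using less.prems by simp
        have "x w = 0" if "w \<in> root_path G r (vs ! ?u)" for w
        proof (rule x)
          show "w \<in> pverts G - {r}" using that root_path_subset[OF vs_in[OF u(1)]] by auto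
          show "gdist G r w \<le> height q"
            using root_path_mono[OF vs_in[OF u(1)] that] le q by (simp add: lev_def)
        qed
        then show ?thesis by simp
      qed
      then show ?thesis using sum pi by linarith
    qed
  qed
qed

text \<open>Climb as long as the potential above is positive; this stops at the latest at the top of
  the group, where the dummy has potential 0. The root is never selected since its potential is
  0.\<close>

lemma root_path_visits_top:
  assumes "potential p" and pr: "\<And>i. i < n \<Longrightarrow> vs ! i = r \<Longrightarrow> p i = 0"
    and "j < n" "0 < p j"
  shows "\<exists>k<n. 0 < p k \<and> p (ep k) \<le> 0 \<and> vs ! k \<in> root_path G r (vs ! j)"
  using assms(3,4)
proof (induction j rule: forest_induct)
  case (top v)
  then have "vs ! v \<noteq> r" using pr[of v] by auto
  then have "vs ! v \<in> root_path G r (vs ! v)" using root_path_parent(1)[of "vs ! v"] top by simp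
  moreover have "p (ep v) = 0" using top assms(1) by (simp add: potential_def)
  ultimately show ?case using top by auto
next
  case (step v)
  then have "vs ! v \<noteq> r" using lev_0_iff[of v] by auto
  then have rp: "root_path G r (vs ! v) = insert (vs ! v) (root_path G r (parent (vs ! v)))"
    using root_path_parent(1)[of "vs ! v"] step by simp
  have "ep v = par_ix v" using step(2) by (auto simp: ep_def split: if_splits)
  then have e: "vs ! ep v = parent (vs ! v)" using par_ix[of v] step by simp
  show ?case
  proof (cases "p (ep v) \<le> 0")
    case True
    then show ?thesis using step rp by auto
  next
    case False
    then obtain k where "k < n" "0 < p k" "p (ep k) \<le> 0" "vs ! k \<in> root_path G r (vs ! ep v)"
      using step(4) by auto
    then show ?thesis using rp e by auto
  qed
qed

end

section \<open>Correctness on a given instance\<close>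

locale tree_instance = enumerated_tree G r vs
  for G :: "'a pair_pre_digraph" and r :: 'a and vs :: "'a list" +
  fixes B \<mu> :: real and q :: nat and x :: "'a \<Rightarrow> real" and h :: int
  assumes \<mu>: "0 < \<mu>" and q: "1 \<le> q"
    and log_defined: "iter_log_defined q (real (depth G r))"
    and h: "h = \<lfloor>iter_log q (real (depth G r))\<rfloor>"
    and x: "x \<in> P G r B" and supp: "supp G r x \<subseteq> levels_above G r h"
begin

definition input :: store where
  "input = input_store G r vs B \<mu> q x"

text \<open>\<open>x\<close> is arbitrary at the root, where the input array holds 0.\<close>

definition y :: "nat \<Rightarrow> real" where
  "y i = real q / \<mu> * (if vs ! i = r then 0 else x (vs ! i))"

lemma input_simps [simp]:
  "nats input ''n'' 0 0 = n" "nats input ''q'' 0 0 = q" "reals input ''mu'' 0 0 = \<mu>"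
  "i < n \<Longrightarrow> nats input ''root'' i 0 = of_bool (vs ! i = r)"
  "i < n \<Longrightarrow> j < n \<Longrightarrow> nats input ''adj'' i j = of_bool ((vs ! i, vs ! j) \<in> parcs G)"
  "i < n \<Longrightarrow> reals input ''x'' i 0 = (if vs ! i = r then 0 else x (vs ! i))"
  "nats input ''H'' = (\<lambda>_ _. 0)" "nats input ''start'' = (\<lambda>_ _. 0)" "nats input ''R'' = (\<lambda>_ _. 0)"
  "reals input ''p'' = (\<lambda>_ _. 0)" "reals input ''D'' = (\<lambda>_ _. 0)"
  by (auto simp: input_def input_store_def)

lemma x_nonneg: "w \<in> pverts G - {r} \<Longrightarrow> 0 \<le> x w"
  using x by (auto simp: P_def)

lemma y_nonneg: "i < n \<Longrightarrow> 0 \<le> y i"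
  using x_nonneg \<mu> by (auto simp: y_def)

lemma x_below: "w \<in> pverts G - {r} \<Longrightarrow> int (gdist G r w) \<le> h \<Longrightarrow> x w = 0"
  using supp x_nonneg[of w] by (force simp: supp_def levels_above_def level_def)

lemma height_q: "height q = nat h"
  using floor_log_iter[OF log_defined, of q] by (simp add: height_def h)

text \<open>The interface between program and mathematics: \<open>p\<close> is the potential before
  rounding and \<open>p'\<close> the one after it. Nothing else about the run is used for
  correctness.\<close>

lemma run_algorithm:
  obtains p p' where
    "p n = 0" "\<And>i. i < n \<Longrightarrow> p i = min 1 (p (ep i) + y i)"
    "improves p p'" "balanced p'"
    "\<And>i. i < n \<Longrightarrow> nats (run algorithm input) ''R'' i 0 \<noteq> 0 \<longleftrightarrow> 0 < p' i \<and> p' (ep i) \<le> 0"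
proof -
  define s1 where "s1 = run init_levels input"
  define s2 where "s2 = run relax_levels s1"
  define s3 where "s3 = run max_level s2"
  define s4 where "s4 = run mark_starts s3"
  define s5 where "s5 = run clear_parents s4"
  define s6 where "s6 = run link_all s5"
  define s7 where "s7 = run init_potential s6"
  define s8 where "s8 = run round_potential s7"
  have run_eq: "run algorithm input = run select_tops s8"
    by (simp add: algorithm_def s1_def s2_def s3_def s4_def s5_def s6_def s7_def s8_def)
  note sdefs = s1_def s2_def s3_def s4_def s5_def s6_def s7_def s8_def
  have ns: "nats s ''n'' = nats input ''n''" if "s \<in> {s1, s2, s3, s4, s5, s6, s7, s8}" for s
    using that by (auto simp: sdefs nats_frame)
  have n [simp]: "nats s ''n'' 0 0 = n" if "s \<in> {s1, s2, s3, s4, s5, s6, s7, s8}" for s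
    using ns[OF that] by simp
  have adj: "nats s ''adj'' i j \<noteq> 0 \<longleftrightarrow> (vs ! i, vs ! j) \<in> parcs G"
    if "s \<in> {s1, s2, s3, s4, s5}" "i < n" "j < n" for s i j
  proof -
    have "nats s ''adj'' = nats input ''adj''" using that(1) by (auto simp: sdefs nats_frame)
    then show ?thesis using that by simp
  qed
  have lev1: "nats s1 ''lev'' i 0 = (if vs ! i = r then 0 else n)" if "i < n" for i
    using init_levels[of input n i] that by (simp add: s1_def)
  have lev2: "nats s2 ''lev'' i 0 = lev i" if "i < n" for i
    unfolding s2_def
  proof (rule relax_levels[of s1 n])
    show "lev j \<le> Suc (lev i)" if "i < n" "j < n" "nats s1 ''adj'' i j \<noteq> 0" for i j
      using adj[of s1 i j] that gdist_arc by (simp add: lev_def)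
    show "\<exists>i<n. nats s1 ''adj'' i j \<noteq> 0 \<and> lev j = Suc (lev i)" if j: "j < n" "lev j \<noteq> 0" for j
    proof -
      have "vs ! j \<noteq> r" using j lev_0_iff by auto
      then have "(vs ! par_ix j, vs ! j) \<in> parcs G"
        using parent_arc[of "vs ! j"] par_ix[of j] j by simp
      then show ?thesis using par_ix(1)[of j] lev_par_ix[of j] adj[of s1 "par_ix j" j] j by auto
    qed
    show "lev j \<le> nats s1 ''lev'' j 0" if "j < n" for j
      using lev1[OF that] lev_0_iff[OF that] lev_less[OF that] by auto
    show "nats s1 ''lev'' j 0 = 0" if "j < n" "lev j = 0" for j
      using lev1[OF that(1)] lev_0_iff[OF that(1)] that(2) by auto
  qed (use that lev_less less_imp_le in auto)
  have "nats s2 ''H'' = nats input ''H''" by (simp add: sdefs nats_frame)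
  then have "nats s2 ''H'' 0 0 = 0" by simp
  note ml = max_level[OF n this s3_def, simplified]
  have H: "nats s3 ''H'' 0 0 = depth G r"
  proof (rule antisym)
    show "nats s3 ''H'' 0 0 \<le> depth G r"
      using ml(2) lev2 lev_le_depth by auto
    show "depth G r \<le> nats s3 ''H'' 0 0"
      using ml(1) lev2 depth_attained by metis
  qed
  have "nats s3 ''start'' = nats input ''start''" by (simp add: sdefs nats_frame)
  then have start: "nats s4 ''start'' l 0 \<noteq> 0 \<longleftrightarrow> is_start l" for l
    using mark_starts[OF _ H, of n l] depth_less is_start_iff[of l]
    by (simp add: s4_def height_def)
  have "nats s5 ''lev'' = nats s2 ''lev''" "nats s5 ''start'' = nats s4 ''start''"
    by (simp_all add: s3_def s4_def s5_def nats_frame)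
  then have links: "links s5 i j \<longleftrightarrow>
      (vs ! i, vs ! j) \<in> parcs G \<and> lev i < lev j \<and> \<not> is_start (lev j)" if "i < n" "j < n" for i j
    using adj[of s5 i j] start[of "lev j"] lev2 that by (auto simp: links_def)
  have uniq: "i = par_ix j" if "i < n" "j < n" "links s5 i j" for i j
  proof -
    have "vs ! i = parent (vs ! j)"
      using that links[of i j] pred_unique[of "vs ! i" "vs ! j"] by (simp add: lev_def)
    then show ?thesis using vs_inj[of i "par_ix j"] par_ix[of j] that by simp
  qed
  have ep6: "nats s6 ''ep'' j 0 = ep j" if j: "j < n" for j
  proof -
    have "(\<exists>i<n. links s5 i j) \<longleftrightarrow> lev j \<noteq> 0 \<and> \<not> is_start (lev j)"
    proof
      assume "lev j \<noteq> 0 \<and> \<not> is_start (lev j)"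
      moreover from this have "(vs ! par_ix j, vs ! j) \<in> parcs G"
        using parent_arc[of "vs ! j"] par_ix[of j] j lev_0_iff[of j] by auto
      ultimately show "\<exists>i<n. links s5 i j"
        using links[OF par_ix(1)[OF j] j] lev_par_ix[OF j] par_ix(1)[OF j] by auto
    qed (use links j in fastforce)
    then show ?thesis
      using link_all[of s5 n j par_ix] uniq j clear_parents[of s4 n j]
      by (simp add: s6_def ep_def) (simp add: s5_def)
  qed
  have lev6: "nats s6 ''lev'' i 0 = lev i" if "i < n" for i
  proof -
    have "nats s6 ''lev'' = nats s2 ''lev''"
      by (simp add: s3_def s4_def s5_def s6_def nats_frame)
    then show ?thesis using lev2[OF that] by simp
  qed
  have ag6: "agrees s6" using ep6 lev6 by (simp add: agrees_def)
  have ag: "agrees s7" "agrees s8"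
    using agrees_cong[of s7 s6] agrees_cong[of s8 s7] ag6 by (simp_all add: s7_def s8_def nats_frame)
  have r6: "reals s6 = reals input" by (rule ext) (simp add: sdefs reals_frame)
  have "nats s6 ''q'' = nats input ''q''" by (simp add: sdefs nats_frame)
  then have sc: "scaled s6 i = y i" if "i < n" for i
    using that by (simp add: scaled_def r6 y_def)
  have p6: "pot s6 n = 0" by (simp add: pot_def r6)
  have p7: "pot s7 n = 0"
    by (rule init_potential(1)[OF ag6 _ p6 s7_def]) (rule lev_less)
  have p: "pot s7 i = min 1 (pot s7 (ep i) + y i)" if "i < n" for i
    using init_potential(2)[OF ag6 _ p6 s7_def that] lev_less sc[OF that] by simp
  have pot7: "potential (pot s7)"
    unfolding potential_def
  proof (intro conjI allI impI)
    show "pot s7 n = 0" by (rule p7)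
    fix v assume v: "v < n"
    have le1: "pot s7 w \<le> 1" if "w < n" for w using p[OF that] by simp
    show "pot s7 v \<le> 1" by (rule le1[OF v])
    have "pot s7 (ep v) \<le> 1" using v by (cases rule: ep_cases) (use le1 p7 in auto)
    then show "pot s7 (ep v) \<le> pot s7 v" using p[OF v] y_nonneg[OF v] by simp
  qed
  have "reals s7 ''D'' = reals input ''D''" by (simp add: s7_def reals_frame r6)
  then have D7: "reals s7 ''D'' i n = 0" for i by simp
  have rp: "improves (pot s7) (pot s8)"
    by (rule round_potential(1)[OF ag(1) _ pot7 D7 s8_def]) (rule lev_less)
  have bal: "balanced (pot s8)"
    by (rule round_potential(2)[OF ag(1) _ pot7 D7 s8_def]) (rule lev_less)
  have "nats s8 ''R'' = nats input ''R''" by (simp add: sdefs nats_frame)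
  then have "nats (run algorithm input) ''R'' i 0 \<noteq> 0 \<longleftrightarrow> 0 < pot s8 i \<and> pot s8 (ep i) \<le> 0"
    if "i < n" for i
    using select_tops[of s8 n i] that agreesD[OF ag(2)] by (simp add: run_eq)
  with p7 p rp bal show ?thesis using that by blast
qed

theorem correctness:
  assumes R: "R = output_set vs (run algorithm input)"
  shows "R \<subseteq> levels_above G r h" and "R \<subseteq> pverts G - {r}"
    and "u \<in> leaves G r \<Longrightarrow> \<mu> \<le> sum x (root_path G r u) \<Longrightarrow> R \<inter> root_path G r u \<noteq> {}"
    and "indicat_real R \<in> P G r (real q / \<mu> * B + 1)"
proof -
  obtain p p' where pn: "p n = 0" and p: "\<And>i. i < n \<Longrightarrow> p i = min 1 (p (ep i) + y i)"
    and imp: "improves p p'" and bal: "balanced p'"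
    and out: "\<And>i. i < n \<Longrightarrow>
      nats (run algorithm input) ''R'' i 0 \<noteq> 0 \<longleftrightarrow> 0 < p' i \<and> p' (ep i) \<le> 0"
    using run_algorithm by blast
  have R_eq: "R = {vs ! i | i. i < n \<and> 0 < p' i \<and> p' (ep i) \<le> 0}"
    using out by (auto simp: R output_set_def)
  have pot': "potential p'" and load: "level_load l p' = level_load l p"
    and ones: "\<And>v. v < n \<Longrightarrow> p v = 1 \<Longrightarrow> p' v = 1"
    and zeros: "\<And>v. v < n \<Longrightarrow> p v = 0 \<Longrightarrow> p' v = 0" for l
    using imp by (auto simp: improves_def)
  have nonneg: "0 \<le> p i" if "i < n" for i
    using that
  proof (induction i rule: forest_induct)
    case (top v)
    then show ?case using p[of v] pn y_nonneg[of v] by simp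
  next
    case (step v)
    then show ?case using p[of v] y_nonneg[of v] by simp
  qed
  have root0: "p' i = 0" if "i < n" "vs ! i = r" for i
  proof (rule zeros[OF that(1)])
    have "ep i = n" using that lev_0_iff by (simp add: ep_def)
    then show "p i = 0" using p[OF that(1)] pn that by (simp add: y_def)
  qed
  \<comment> \<open>A nonzero potential stems from weight at \<open>i\<close> or at an ancestor in
    its group, and the level only grows from that ancestor down to \<open>i\<close>.\<close>
  have above: "h < int (lev i)" if "i < n" "p i \<noteq> 0" for i
    using that
  proof (induction i rule: forest_induct)
    case (top v)
    then have "y v \<noteq> 0" using p[of v] pn by auto
    then show ?case using x_below[of "vs ! v"] top
      by (force simp: y_def lev_def split: if_splits)
  next
    case (step v)
    show ?case
    proof (cases "p (ep v) = 0")
      case True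
      then have "y v \<noteq> 0" using p[of v] step by auto
      then show ?thesis using x_below[of "vs ! v"] step
        by (force simp: y_def lev_def split: if_splits)
    next
      case False
      then show ?thesis using step by simp
    qed
  qed
  show "R \<subseteq> levels_above G r h"
  proof
    fix w assume "w \<in> R"
    then obtain i where i: "w = vs ! i" "i < n" "0 < p' i" by (auto simp: R_eq)
    then have "p i \<noteq> 0" using zeros[of i] by auto
    then show "w \<in> levels_above G r h"
      using above[of i] i by (auto simp: levels_above_def level_def lev_def)
  qed
  show "R \<subseteq> pverts G - {r}"
    using root0 by (force simp: R_eq)
  show "R \<inter> root_path G r u \<noteq> {}" if u: "u \<in> leaves G r" "\<mu> \<le> sum x (root_path G r u)"
  proof -
    obtain i where i: "i < n" "vs ! i = u" using vs_ix[of u] u(1) by (auto simp: leaves_def)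
    \<comment> \<open>\<open>path_weight_le\<close> asks for value 0 at the root, where
      \<open>x\<close> is arbitrary; root paths avoid the root, so the sums agree.\<close>
    let ?z = "\<lambda>w. if w = r then 0 else x w"
    have sum_z: "sum ?z (root_path G r u) = sum x (root_path G r u)"
      using root_path_subset[of u] i by (intro sum.cong) auto
    have "\<exists>j<n. vs ! j \<in> root_path G r u \<and> \<not> p j < 1"
    proof (rule ccontr)
      assume "\<not> ?thesis"
      then have lt1: "p j < 1" if "j < n" "vs ! j \<in> root_path G r u" for j using that by blast
      \<comment> \<open>This is the case \<open>a = 0\<close>. Without a potential 1 on the path the
        scaled weight stays below \<open>(q - 1) + 1\<close>, whereas weight at least
        \<open>\<mu>\<close> scales to at least \<open>q\<close>.\<close>
      have "real q / \<mu> * sum ?z (root_path G r (vs ! i)) \<le> real (q - Suc 0) + p i"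
      proof (rule path_weight_le)
        show "p i = min 1 (p (ep i) + real q / \<mu> * ?z (vs ! i))" if "i < n" for i
          using p[OF that] by (simp add: y_def)
        show "?z w = 0" if "w \<in> pverts G - {r}" "gdist G r w \<le> height q" for w
        proof -
          \<comment> \<open>A positive distance rules out \<open>h \<le> 0\<close>, so
            \<open>nat h\<close> really is \<open>h\<close>.\<close>
          have "gdist G r w \<noteq> 0" using that gdist_eq_0_iff[of w] by auto
          then have "int (gdist G r w) \<le> h" using that height_q by linarith
          then show ?thesis using x_below that by simp
        qed
      qed (use pn nonneg i q lev_le_depth lt1 in auto)
      moreover have "p i < 1"
      proof (rule lt1[OF i(1)])
        show "vs ! i \<in> root_path G r u"
          using root_path_parent(1)[of u] u i by (auto simp: leaves_def)
      qed
      moreover have "real (q - Suc 0) = real q - 1" using q by simp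
      moreover have "real q / \<mu> * \<mu> \<le> real q / \<mu> * sum ?z (root_path G r (vs ! i))"
        using u(2) sum_z i(2) \<mu> by (intro mult_left_mono) auto
      ultimately show False using \<mu> by simp
    qed
    then obtain j where j: "j < n" "vs ! j \<in> root_path G r u" "\<not> p j < 1" by blast
    then have "p j = 1" using p[of j] by simp
    then have "0 < p' j" using ones j by simp
    then obtain k where k: "k < n" "0 < p' k" "p' (ep k) \<le> 0" "vs ! k \<in> root_path G r (vs ! j)"
      using root_path_visits_top[OF pot' root0 j(1)] by blast
    have "root_path G r (vs ! j) \<subseteq> root_path G r u"
      using root_path_mono[of u "vs ! j"] i j by auto
    then show ?thesis using k by (auto simp: R_eq)
  qed
  have "sum (indicat_real R) (level G r l) \<le> (real q / \<mu> * B + 1) * 2 ^ l"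
    if l: "l \<in> {1..depth G r}" for l
  proof -
    let ?T = "{v. v < n \<and> lev v = l \<and> 0 < p' v \<and> p' (ep v) \<le> 0}"
    obtain a where a: "l \<in> {height (Suc a)<..height a}" using group_exists[of l] l by auto
    have not_root: "vs ! i \<noteq> r" if "i < n \<and> lev i = l" for i
      using lev_0_iff[of i] that l by auto
    have in_R: "vs ! i \<in> R \<longleftrightarrow> 0 < p' i \<and> p' (ep i) \<le> 0" if "i < n" for i
      using that vs_inj by (auto simp: R_eq)
    have "sum (indicat_real R) (level G r l) = (\<Sum>i | i < n \<and> lev i = l. indicat_real ?T i)"
      unfolding sum_level by (intro sum.cong) (auto simp: indicator_def in_R)
    also have "\<dots> = (\<Sum>i\<in>?T. 1)"
      by (intro sum.mono_neutral_cong_right) (auto simp: indicator_def)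
    also have "\<dots> = card ?T" by simp
    also have "\<dots> \<le> level_load l p' + card ({height (Suc a)<..height a} \<inter> {..<n})"
      by (rule card_tops_le[OF pot' bal closed_group a])
    also have "\<dots> \<le> level_load l p + 2 ^ l"
    proof -
      have "real (card ({height (Suc a)<..height a} \<inter> {..<n})) \<le> real (2 ^ l)"
        using card_group_le[OF a] by (rule of_nat_mono)
      then show ?thesis by (simp add: load)
    qed
    \<comment> \<open>Truncation at 1 can only make the increment \<open>p v - p (ep v)\<close>
      smaller than \<open>y v\<close>.\<close>
    also have "level_load l p \<le> (\<Sum>v | v < n \<and> lev v = l. y v)"
      unfolding level_load_def using p by (intro sum_mono) simp
    also have "\<dots> = real q / \<mu> * sum x (level G r l)"
      unfolding sum_level sum_distrib_left
      by (intro sum.cong) (simp_all add: y_def not_root)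
    also have "\<dots> \<le> real q / \<mu> * (B * 2 ^ l)"
      using x l \<mu> by (intro mult_left_mono) (auto simp: P_def)
    finally show ?thesis by (simp add: distrib_right)
  qed
  then show "indicat_real R \<in> P G r (real q / \<mu> * B + 1)"
    by (simp add: P_def)
qed

end

text \<open>\<open>R \<subseteq> pverts G - {r}\<close> is asserted separately because a negative
  \<open>h\<close> admits the root to \<open>levels_above G r h\<close>.\<close>

theorem theorem11:
  shows "\<exists>(A :: com) (c :: nat) (k :: nat).
    \<forall>(G :: 'a pair_pre_digraph) (r :: 'a) (vs :: 'a list) (B :: real) (\<mu> :: real) (q :: nat)
       (x :: 'a \<Rightarrow> real) (h :: int) (W :: 'a set).
      rooted_tree G r \<longrightarrow> distinct vs \<longrightarrow> set vs = pverts G \<longrightarrow>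
      1 \<le> B \<longrightarrow> 0 < \<mu> \<longrightarrow> \<mu> \<le> 1 \<longrightarrow> 1 \<le> q \<longrightarrow>
      iter_log_defined q (real (depth G r)) \<longrightarrow>
      h = \<lfloor>iter_log q (real (depth G r))\<rfloor> \<longrightarrow>
      x \<in> P G r B \<longrightarrow> supp G r x \<subseteq> levels_above G r h \<longrightarrow>
      W = {u \<in> leaves G r. \<mu> \<le> sum x (root_path G r u)} \<longrightarrow>
      time A (input_store G r vs B \<mu> q x) \<le> c * card (pverts G) ^ k \<and>
      (\<exists>R. R = output_set vs (run A (input_store G r vs B \<mu> q x)) \<and>
           R \<subseteq> levels_above G r h \<and> R \<subseteq> pverts G - {r} \<and>
           (\<forall>u\<in>W. R \<inter> root_path G r u \<noteq> {}) \<and>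
           indicat_real R \<in> P G r (real q / \<mu> * B + 1))"
proof (rule exI[of _ algorithm], rule exI[of _ "com_size algorithm"],
    rule exI[of _ "nesting algorithm"], intro allI impI)
  fix G :: "'a pair_pre_digraph" and r :: 'a and vs :: "'a list" and B \<mu> :: real and q :: nat
    and x :: "'a \<Rightarrow> real" and h :: int and W :: "'a set"
  assume "rooted_tree G r" "distinct vs" "set vs = pverts G" "1 \<le> B" "0 < \<mu>" "\<mu> \<le> 1" "1 \<le> q"
    "iter_log_defined q (real (depth G r))" "h = \<lfloor>iter_log q (real (depth G r))\<rfloor>"
    "x \<in> P G r B" "supp G r x \<subseteq> levels_above G r h"
    and W: "W = {u \<in> leaves G r. \<mu> \<le> sum x (root_path G r u)}"
  then interpret tree_instance G r vs B \<mu> q x h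
    by unfold_locales auto
  have "time algorithm input \<le> com_size algorithm * n ^ nesting algorithm"
  proof (rule time_le[OF n_bounded_algorithm])
    show "''n'' \<notin> nwrites algorithm" by (simp add: algorithm_def)
    show "1 \<le> n" using depth_less by simp
  qed simp
  then show "time algorithm (input_store G r vs B \<mu> q x) \<le>
      com_size algorithm * card (pverts G) ^ nesting algorithm \<and>
    (\<exists>R. R = output_set vs (run algorithm (input_store G r vs B \<mu> q x)) \<and>
       R \<subseteq> levels_above G r h \<and> R \<subseteq> pverts G - {r} \<and>
       (\<forall>u\<in>W. R \<inter> root_path G r u \<noteq> {}) \<and>
       indicat_real R \<in> P G r (real q / \<mu> * B + 1))"
    using correctness[OF refl] by (auto simp: input_def n_card W)
qed

end
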